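(* Let $G$ be an $\mathsf A_\ell$-graded group with $\ell\ge3$. Then there exist an associative unital ring $R$ and a group homomorphism $Q\colon\mathrm{St}(\ell+1,R)\to G$ inducing isomorphisms between the root subgroups. Moreover, fix such $R$ and $Q$. For an associative unital ring $R'$, the homomorphisms $Q'\colon\mathrm{St}(\ell+1,R')\to G$ inducing isomorphisms between the root subgroups are precisely those of the following type: choose a ring isomorphism $F\colon R'\to R$ and elements $a_1,\dots,a_{\ell+1}\in R^*$ and let $Q'(t_{ij}(x))=Q\bigl(t_{ij}(a_i\,F(x)\,a_j^{-1})\bigr)$ for all $i\ne j$, $x\in R'$. The tuple $(F,a_1,\dots,a_{\ell+1})$ is uniquely determined by $Q'$ up to the change $F\mapsto c^{-1}Fc$, $a_i\mapsto a_ic$ for $c\in R^*$.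
   Context: Conventions: $[f,g]=fgf^{-1}g^{-1}$, ${}^{f}g=fgf^{-1}$. $\mathsf A_\ell=\{\mathrm e_i-\mathrm e_j\mid1\le i\ne j\le\ell+1\}$. For a root system $\Phi$ and linearly independent $\alpha,\beta\in\Phi$ let $]\alpha,\beta[\;=\Phi\cap(\mathbb R_{>0}\alpha+\mathbb R_{>0}\beta)$. A subset $\Sigma\subseteq\Phi$ is special closed if it is the intersection of $\Phi$ with a convex cone not containing opposite non-zero vectors; $\alpha\in\Sigma$ is extreme if it lies on an extreme ray of the conical convex hull of $\Sigma$. A group $G$ has $\Phi$-commutator relations if it has a family of subgroups $(G_\alpha)_{\alpha\in\Phi}$ such that $[G_\alpha,G_\beta]\le\langle G_\gamma\mid\gamma\in\,]\alpha,\beta[\,\rangle$ for all linearly independent $\alpha,\beta\in\Phi$, and $G_\alpha\cap\langle G_\beta\mid\beta\in\Sigma\setminus\{\alpha\}\rangle=1$ for all special closed $\Sigma\subseteq\Phi$ and all extreme $\alpha\in\Sigma$. An $\alpha$-Weyl element is an element $n\in G_\alpha G_{-\alpha}G_\alpha$ with ${}^nG_\beta=G_{s_\alpha(\beta)}$ for all $\beta\in\Phi$, where $s_\alpha$ is the reflection. $G$ is $\Phi$-graded if moreover for every $\alpha\in\Phi$ there exists an $\alpha$-Weyl element. For an associative unital ring $R$ and $m\ge3$, the Steinberg group $\mathrm{St}(m,R)$ has generators $t_{ij}(x)$, $1\le i\ne j\le m$, $x\in R$, and relations $t_{ij}(x)t_{ij}(x')=t_{ij}(x+x')$; $[t_{ij}(x),t_{jk}(y)]=t_{ik}(xy)$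 for $i\ne k$; $[t_{ij}(x),t_{kl}(y)]=1$ for $j\ne k$ and $i\ne l$. It is $\mathsf A_{m-1}$-graded with root subgroups $t_{ij}(R)$ for the root $\mathrm e_i-\mathrm e_j$. "$Q$ induces isomorphisms between the root subgroups" means that $x\mapsto Q(t_{ij}(x))$ is an isomorphism of the additive group of the ring onto $G_{\mathrm e_i-\mathrm e_j}$ for all $i\ne j$. *)

theory Defs
  imports "HOL-Analysis.Analysis" "HOL-Algebra.QuotRing" "HOL-Algebra.Generated_Groups"
begin

section \<open>Root systems and graded groups\<close>

text \<open>
  The root system of type A, living in the Euclidean space with coordinates indexed by the
  finite type \<open>'n\<close>; its rank is \<open>CARD('n) - 1\<close>.
\<close>

definition A_roots :: "(real ^ 'n) set" where
  "A_roots = {axis i 1 - axis j 1 | i j. i \<noteq> j}"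

definition reflect :: "'v::euclidean_space \<Rightarrow> 'v \<Rightarrow> 'v" where
  "reflect \<alpha> v = v - (2 * (v \<bullet> \<alpha>) / (\<alpha> \<bullet> \<alpha>)) *\<^sub>R \<alpha>"

definition open_root_interval :: "'v::euclidean_space set \<Rightarrow> 'v \<Rightarrow> 'v \<Rightarrow> 'v set" where
  "open_root_interval \<Phi> \<alpha> \<beta> = \<Phi> \<inter> {a *\<^sub>R \<alpha> + b *\<^sub>R \<beta> | a b. a > 0 \<and> b > 0}"

definition special_closed :: "'v::euclidean_space set \<Rightarrow> 'v set \<Rightarrow> bool" where
  "special_closed \<Phi> \<Sigma> \<longleftrightarrow>
     (\<exists>C. convex_cone C \<and> (\<forall>v. v \<in> C \<and> - v \<in> C \<longrightarrow> v = 0) \<and> \<Sigma> = \<Phi> \<inter> C)"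

definition extreme_ray_of :: "'v::euclidean_space set \<Rightarrow> 'v set \<Rightarrow> bool" where
  "extreme_ray_of r C \<longleftrightarrow> (\<exists>v. v \<noteq> 0 \<and> r = {c *\<^sub>R v | c. c \<ge> 0}) \<and> r face_of C"

definition extreme_in :: "'v::euclidean_space set \<Rightarrow> 'v \<Rightarrow> bool" where
  "extreme_in \<Sigma> \<alpha> \<longleftrightarrow> \<alpha> \<in> \<Sigma> \<and> (\<exists>r. extreme_ray_of r (convex_cone hull \<Sigma>) \<and> \<alpha> \<in> r)"

definition commutator :: "('g, 'z) monoid_scheme \<Rightarrow> 'g \<Rightarrow> 'g \<Rightarrow> 'g" where
  "commutator G f g = f \<otimes>\<^bsub>G\<^esub> g \<otimes>\<^bsub>G\<^esub> inv\<^bsub>G\<^esub> f \<otimes>\<^bsub>G\<^esub> inv\<^bsub>G\<^esub> g"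

definition commutator_subgroup :: "('g, 'z) monoid_scheme \<Rightarrow> 'g set \<Rightarrow> 'g set \<Rightarrow> 'g set" where
  "commutator_subgroup G H K = generate G {commutator G h k | h k. h \<in> H \<and> k \<in> K}"

text \<open>
  Linear independence of the pair \<open>\<alpha>, \<beta>\<close> needs \<open>\<alpha> \<noteq> \<beta>\<close> in addition to independence of the
  set \<open>{\<alpha>, \<beta>}\<close>. Only the values of \<open>Gs\<close> on \<open>\<Phi>\<close> are relevant.
\<close>

definition has_commutator_relations ::
    "'v::euclidean_space set \<Rightarrow> ('g, 'z) monoid_scheme \<Rightarrow> ('v \<Rightarrow> 'g set) \<Rightarrow> bool" where
  "has_commutator_relations \<Phi> G Gs \<longleftrightarrow>
     (\<forall>\<alpha>\<in>\<Phi>. subgroup (Gs \<alpha>) G) \<and>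
     (\<forall>\<alpha>\<in>\<Phi>. \<forall>\<beta>\<in>\<Phi>. \<alpha> \<noteq> \<beta> \<and> independent {\<alpha>, \<beta>} \<longrightarrow>
        commutator_subgroup G (Gs \<alpha>) (Gs \<beta>)
          \<subseteq> generate G (\<Union>\<gamma>\<in>open_root_interval \<Phi> \<alpha> \<beta>. Gs \<gamma>)) \<and>
     (\<forall>\<Sigma> \<alpha>. special_closed \<Phi> \<Sigma> \<and> extreme_in \<Sigma> \<alpha> \<longrightarrow>
        Gs \<alpha> \<inter> generate G (\<Union>\<beta>\<in>\<Sigma> - {\<alpha>}. Gs \<beta>) = {\<one>\<^bsub>G\<^esub>})"

definition Weyl_element ::
    "'v::euclidean_space set \<Rightarrow> ('g, 'z) monoid_scheme \<Rightarrow> ('v \<Rightarrow> 'g set) \<Rightarrow> 'v \<Rightarrow> 'g \<Rightarrow> bool" where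
  "Weyl_element \<Phi> G Gs \<alpha> n \<longleftrightarrow>
     n \<in> Gs \<alpha> <#>\<^bsub>G\<^esub> Gs (- \<alpha>) <#>\<^bsub>G\<^esub> Gs \<alpha> \<and>
     (\<forall>\<beta>\<in>\<Phi>. (\<lambda>g. n \<otimes>\<^bsub>G\<^esub> g \<otimes>\<^bsub>G\<^esub> inv\<^bsub>G\<^esub> n) ` Gs \<beta> = Gs (reflect \<alpha> \<beta>))"

definition graded_group ::
    "'v::euclidean_space set \<Rightarrow> ('g, 'z) monoid_scheme \<Rightarrow> ('v \<Rightarrow> 'g set) \<Rightarrow> bool" where
  "graded_group \<Phi> G Gs \<longleftrightarrow>
     group G \<and> has_commutator_relations \<Phi> G Gs \<and> (\<forall>\<alpha>\<in>\<Phi>. \<exists>n. Weyl_element \<Phi> G Gs \<alpha> n)"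


section \<open>Groups given by generators and relations\<close>

text \<open>
  A word is a list of letters; the letter \<open>(True, x)\<close> stands for the generator \<open>x\<close> and
  \<open>(False, x)\<close> for its inverse. A pair \<open>(u, v)\<close> in \<open>E\<close> is the defining relation \<open>u = v\<close>.
\<close>

type_synonym 'x word = "(bool \<times> 'x) list"

definition words :: "'x set \<Rightarrow> 'x word set" where
  "words X = lists (UNIV \<times> X)"

definition word_inv :: "'x word \<Rightarrow> 'x word" where
  "word_inv w = rev (map (\<lambda>(b, x). (\<not> b, x)) w)"

definition word_comm :: "'x word \<Rightarrow> 'x word \<Rightarrow> 'x word" where
  "word_comm u v = u @ v @ word_inv u @ word_inv v"

inductive_set word_rel :: "'x set \<Rightarrow> ('x word \<times> 'x word) set \<Rightarrow> ('x word \<times> 'x word) set"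
  for X :: "'x set" and E :: "('x word \<times> 'x word) set" where
  refl: "u \<in> words X \<Longrightarrow> (u, u) \<in> word_rel X E"
| sym: "(u, v) \<in> word_rel X E \<Longrightarrow> (v, u) \<in> word_rel X E"
| trans: "(u, v) \<in> word_rel X E \<Longrightarrow> (v, w) \<in> word_rel X E \<Longrightarrow> (u, w) \<in> word_rel X E"
| append: "(u, u') \<in> word_rel X E \<Longrightarrow> (v, v') \<in> word_rel X E \<Longrightarrow> (u @ v, u' @ v') \<in> word_rel X E"
| cancel: "x \<in> X \<Longrightarrow> ([(b, x), (\<not> b, x)], []) \<in> word_rel X E"
| relation: "(u, v) \<in> E \<Longrightarrow> u \<in> words X \<Longrightarrow> v \<in> words X \<Longrightarrow> (u, v) \<in> word_rel X E"

definition presented_group ::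
    "'x set \<Rightarrow> ('x word \<times> 'x word) set \<Rightarrow> 'x word set monoid" where
  "presented_group X E =
     \<lparr>carrier = words X // word_rel X E,
      mult = (\<lambda>A B. \<Union>u\<in>A. \<Union>v\<in>B. word_rel X E `` {u @ v}),
      one = word_rel X E `` {[]}\<rparr>"

lemma word_rel_in_words:
  "(u, v) \<in> word_rel X E \<Longrightarrow> u \<in> words X \<and> v \<in> words X"
  by (induction rule: word_rel.induct) (auto simp: words_def)

lemma equiv_word_rel: "equiv (words X) (word_rel X E)"
  by (rule equivI)
    (auto simp: refl_on_def sym_def trans_def dest: word_rel_in_words
      intro: word_rel.refl word_rel.sym word_rel.trans)

lemma presented_group_mult:
  assumes "u \<in> words X" "v \<in> words X"
  shows "word_rel X E `` {u} \<otimes>\<^bsub>presented_group X E\<^esub> word_rel X E `` {v} = word_rel X E `` {u @ v}"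
proof -
  have "word_rel X E `` {u' @ v'} = word_rel X E `` {u @ v}"
    if "(u, u') \<in> word_rel X E" "(v, v') \<in> word_rel X E" for u' v'
    by (metis that equiv_class_eq[OF equiv_word_rel] word_rel.append)
  then show ?thesis
    using assms by (auto simp: presented_group_def intro: word_rel.refl)
qed

lemma word_inv_left: "w \<in> words X \<Longrightarrow> word_inv w \<in> words X \<and> (word_inv w @ w, []) \<in> word_rel X E"
proof (induction w)
  case Nil
  then show ?case by (auto simp: word_inv_def words_def intro: word_rel.refl)
next
  case (Cons l w)
  obtain b x where l: "l = (b, x)" by force
  have x: "x \<in> X" and w: "w \<in> words X" using Cons.prems l by (auto simp: words_def)
  note IH = Cons.IH[OF w]
  have "([(\<not> b, x), (b, x)], []) \<in> word_rel X E"
    using word_rel.cancel[OF x, of "\<not> b"] by simp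
  then have "([(\<not> b, x), (b, x)] @ w, [] @ w) \<in> word_rel X E"
    using w by (rule word_rel.append[OF _ word_rel.refl])
  then have "(word_inv w @ [(\<not> b, x), (b, x)] @ w, word_inv w @ [] @ w) \<in> word_rel X E"
    using IH word_rel.append[OF word_rel.refl, of "word_inv w"] by auto
  then have "(word_inv w @ [(\<not> b, x), (b, x)] @ w, []) \<in> word_rel X E"
    using IH by (auto intro: word_rel.trans)
  then show ?case
    using IH x l by (auto simp: word_inv_def words_def)
qed

lemma group_presented_group: "group (presented_group X E)"
proof -
  let ?P = "presented_group X E" and ?c = "\<lambda>u. word_rel X E `` {u}"
  have carr: "A \<in> carrier ?P \<longleftrightarrow> (\<exists>u\<in>words X. A = ?c u)" for A
    by (auto simp: presented_group_def quotient_def)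
  have one: "\<one>\<^bsub>?P\<^esub> = ?c []" by (simp add: presented_group_def)
  have nil: "[] \<in> words X" and app: "u @ v \<in> words X \<longleftrightarrow> u \<in> words X \<and> v \<in> words X" for u v
    by (auto simp: words_def)
  show ?thesis
  proof (rule groupI)
    fix A assume "A \<in> carrier ?P"
    then obtain u where u: "u \<in> words X" "A = ?c u" by (auto simp: carr)
    have "?c (word_inv u @ u) = ?c []"
      using word_inv_left[OF u(1)] by (intro equiv_class_eq[OF equiv_word_rel]) auto
    then show "\<exists>B\<in>carrier ?P. B \<otimes>\<^bsub>?P\<^esub> A = \<one>\<^bsub>?P\<^esub>"
      using u word_inv_left[OF u(1)]
      by (intro bexI[of _ "?c (word_inv u)"]) (auto simp: carr one presented_group_mult)
  qed (auto simp: carr one app nil presented_group_mult)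
qed


section \<open>Steinberg groups\<close>

text \<open>
  The generator \<open>(i, j, x)\<close> stands for the elementary transvection with entry \<open>x\<close> at position
  \<open>(i, j)\<close>; matrix positions are indexed by the finite type \<open>'n\<close>, so the degree is \<open>CARD('n)\<close>.
\<close>

definition steinberg_gens :: "('r, 'm) ring_scheme \<Rightarrow> ('n::finite \<times> 'n \<times> 'r) set" where
  "steinberg_gens R = {(i, j, x). i \<noteq> j \<and> x \<in> carrier R}"

abbreviation steinberg_letter :: "'n \<Rightarrow> 'n \<Rightarrow> 'r \<Rightarrow> ('n \<times> 'n \<times> 'r) word" where
  "steinberg_letter i j x \<equiv> [(True, (i, j, x))]"

definition steinberg_rels ::
    "('r, 'm) ring_scheme \<Rightarrow> (('n::finite \<times> 'n \<times> 'r) word \<times> ('n \<times> 'n \<times> 'r) word) set" where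
  "steinberg_rels R =
     {(steinberg_letter i j x @ steinberg_letter i j y, steinberg_letter i j (x \<oplus>\<^bsub>R\<^esub> y)) | i j x y.
        i \<noteq> j \<and> x \<in> carrier R \<and> y \<in> carrier R}
   \<union> {(word_comm (steinberg_letter i j x) (steinberg_letter j k y),
        steinberg_letter i k (x \<otimes>\<^bsub>R\<^esub> y)) | i j k x y.
        i \<noteq> j \<and> j \<noteq> k \<and> i \<noteq> k \<and> x \<in> carrier R \<and> y \<in> carrier R}
   \<union> {(word_comm (steinberg_letter i j x) (steinberg_letter k l y), []) | i j k l x y.
        i \<noteq> j \<and> k \<noteq> l \<and> j \<noteq> k \<and> i \<noteq> l \<and> x \<in> carrier R \<and> y \<in> carrier R}"

definition steinberg ::
    "('r, 'm) ring_scheme \<Rightarrow> ('n::finite \<times> 'n \<times> 'r) word set monoid" where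
  "steinberg R = presented_group (steinberg_gens R) (steinberg_rels R)"

definition steinberg_elt ::
    "('r, 'm) ring_scheme \<Rightarrow> 'n::finite \<Rightarrow> 'n \<Rightarrow> 'r \<Rightarrow> ('n \<times> 'n \<times> 'r) word set" where
  "steinberg_elt R i j x =
     word_rel (steinberg_gens R) (steinberg_rels R) `` {steinberg_letter i j x}"

text \<open>Homomorphisms inducing isomorphisms between the root subgroups.\<close>

definition root_iso_homs ::
    "('r, 'm) ring_scheme \<Rightarrow> ('g, 'z) monoid_scheme \<Rightarrow> (real ^ 'n \<Rightarrow> 'g set)
      \<Rightarrow> (('n::finite \<times> 'n \<times> 'r) word set \<Rightarrow> 'g) set" where
  "root_iso_homs R G Gs =
     {Q \<in> hom (steinberg R) G.
        \<forall>i j. i \<noteq> j \<longrightarrow>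
          (\<lambda>x. Q (steinberg_elt R i j x))
            \<in> iso (add_monoid R) (G\<lparr>carrier := Gs (axis i 1 - axis j 1)\<rparr>)}"

definition twisting_data ::
    "('s, 'm) ring_scheme \<Rightarrow> ('r, 'k) ring_scheme \<Rightarrow> ('s \<Rightarrow> 'r) \<Rightarrow> ('n \<Rightarrow> 'r) \<Rightarrow> bool" where
  "twisting_data R' R F a \<longleftrightarrow> F \<in> ring_iso R' R \<and> (\<forall>i. a i \<in> Units R)"

definition is_twist ::
    "('s, 'm) ring_scheme \<Rightarrow> ('r, 'k) ring_scheme \<Rightarrow> ('s \<Rightarrow> 'r) \<Rightarrow> ('n::finite \<Rightarrow> 'r)
      \<Rightarrow> (('n \<times> 'n \<times> 'r) word set \<Rightarrow> 'g) \<Rightarrow> (('n \<times> 'n \<times> 's) word set \<Rightarrow> 'g) \<Rightarrow> bool" where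
  "is_twist R' R F a Q Q' \<longleftrightarrow>
     (\<forall>i j x. i \<noteq> j \<and> x \<in> carrier R' \<longrightarrow>
        Q' (steinberg_elt R' i j x)
          = Q (steinberg_elt R i j (a i \<otimes>\<^bsub>R\<^esub> F x \<otimes>\<^bsub>R\<^esub> inv\<^bsub>R\<^esub> (a j))))"

end

theory Submission
  imports Defs "HOL-Algebra.Weak_Morphisms"
begin

text \<open>
  Write \<open>X i j\<close> for the root subgroup of \<open>e\<^sub>i - e\<^sub>j\<close>. For a Weyl element \<open>n = a b c\<close> of this root,
  computing \<open>n g n\<^sup>-\<^sup>1\<close> for \<open>g\<close> in \<open>X j k\<close> inside \<open>X i k X j k\<close> shows that every element of \<open>X i k\<close>
  is a product of commutators from \<open>[X i j, X j k]\<close>, so that root subgroups are abelian, and that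
  commutation with \<open>c\<close> and \<open>b\<^sup>-\<^sup>1\<close> are mutually inverse bijections between \<open>X j k\<close> and \<open>X i k\<close>.
  Commutation is thus a biadditive composition \<open>X i j \<times> X j k \<rightarrow> X i k\<close>, and for four distinct
  indices it is associative because \<open>X i j\<close> and \<open>X k l\<close> commute. Products of the elements \<open>c\<close> and
  \<open>b\<^sup>-\<^sup>1\<close> belonging to pairs with one fixed index yield elements \<open>e i j\<close> with \<open>[e i j, e j k] = e i k\<close>.
  The ring consists of the families \<open>x i j\<close> in \<open>X i j\<close> with \<open>[x i j, e j k] = x i k = [e i j, x j k]\<close>.
  They are determined by any one of their members, which may be prescribed, and are multiplied by
  \<open>(x y) i k = [x i j, y j k]\<close>; the choice of \<open>j\<close> does not matter, and associativity reduces to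
  four distinct indices.

  For two coordinatizations, the transition maps \<open>f i j\<close> satisfy \<open>f i j x * f j k y = f i k (x * y)\<close>.
  Surjectivity makes the elements \<open>f i j 1\<close> invertible, hence \<open>f i j 1 = a i * (a j)\<^sup>-\<^sup>1\<close>, and
  \<open>(a i)\<^sup>-\<^sup>1 * f i j x * a j\<close> is independent of \<open>i\<close> and \<open>j\<close>.
\<close>

section \<open>Homomorphisms out of presented groups\<close>

definition word_val :: "('g, 'z) monoid_scheme \<Rightarrow> ('x \<Rightarrow> 'g) \<Rightarrow> 'x word \<Rightarrow> 'g" where
  "word_val H \<phi> w =
     foldr (\<lambda>(b, x) g. (if b then \<phi> x else inv\<^bsub>H\<^esub> \<phi> x) \<otimes>\<^bsub>H\<^esub> g) w \<one>\<^bsub>H\<^esub>"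

lemma word_val_Nil [simp]: "word_val H \<phi> [] = \<one>\<^bsub>H\<^esub>"
  by (simp add: word_val_def)

lemma word_val_Cons [simp]:
  "word_val H \<phi> ((b, x) # w) = (if b then \<phi> x else inv\<^bsub>H\<^esub> \<phi> x) \<otimes>\<^bsub>H\<^esub> word_val H \<phi> w"
  by (simp add: word_val_def)

lemma words_Cons [simp]: "(b, x) # w \<in> words X \<longleftrightarrow> x \<in> X \<and> w \<in> words X"
  by (auto simp: words_def)

lemma words_Nil [simp]: "[] \<in> words X"
  by (simp add: words_def)

lemma words_append [simp]: "u @ v \<in> words X \<longleftrightarrow> u \<in> words X \<and> v \<in> words X"
  by (auto simp: words_def)

context group
begin

lemma word_val_closed:
  assumes "\<phi> \<in> X \<rightarrow> carrier G" "w \<in> words X"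
  shows "word_val G \<phi> w \<in> carrier G"
  using assms(2) by (induction w) (use assms(1) in \<open>auto simp: Pi_iff\<close>)

lemma word_val_append:
  assumes "\<phi> \<in> X \<rightarrow> carrier G" "u \<in> words X" "v \<in> words X"
  shows "word_val G \<phi> (u @ v) = word_val G \<phi> u \<otimes> word_val G \<phi> v"
  using assms(2)
proof (induction u)
  case Nil
  then show ?case using word_val_closed[OF assms(1,3)] by simp
next
  case (Cons l u)
  obtain b x where l: "l = (b, x)" by force
  have "\<phi> x \<in> carrier G" "word_val G \<phi> u \<in> carrier G" "word_val G \<phi> v \<in> carrier G"
    using Cons.prems l assms word_val_closed[OF assms(1)] by (auto simp: Pi_iff)
  then show ?case using Cons l by (simp add: m_assoc)
qed

text \<open>The closure rules and free cancellation are respected by evaluation in every group, so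
  only the defining relations have to be tested.\<close>

lemma word_val_rel:
  assumes "\<phi> \<in> X \<rightarrow> carrier G"
    and "\<And>u v. (u, v) \<in> E \<Longrightarrow> u \<in> words X \<Longrightarrow> v \<in> words X \<Longrightarrow> word_val G \<phi> u = word_val G \<phi> v"
    and "(u, v) \<in> word_rel X E"
  shows "word_val G \<phi> u = word_val G \<phi> v"
  using assms(3)
proof (induction rule: word_rel.induct)
  case (append u u' v v')
  then show ?case
    using word_val_append[OF assms(1)] word_rel_in_words by metis
next
  case (cancel x b)
  then show ?case using assms(1) by (auto simp: Pi_iff)
qed (use assms(2) in auto)

text \<open>A homomorphism is determined by its values on the generators. The rule
  \<open>cancel\<close> is what makes the class of a letter with flag \<open>False\<close> the
  inverse of the class of its generator.\<close>

lemma presented_group_hom_word_val: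
  assumes f: "f \<in> hom (presented_group X E) G" and w: "w \<in> words X"
  shows "f (word_rel X E `` {w}) = word_val G (\<lambda>x. f (word_rel X E `` {[(True, x)]})) w"
  using w
proof (induction w)
  let ?P = "presented_group X E" and ?c = "\<lambda>w. word_rel X E `` {w}"
  interpret P: group ?P by (rule group_presented_group)
  interpret hom: group_hom ?P G f
    using f by unfold_locales
  have carr: "?c u \<in> carrier ?P" if "u \<in> words X" for u
    using that by (auto simp: presented_group_def quotient_def)
  have one: "\<one>\<^bsub>?P\<^esub> = ?c []" by (simp add: presented_group_def)
  {
    case Nil
    then show ?case by (metis hom.hom_one one word_val_Nil)
  next
    case (Cons l w)
    obtain b x where l: "l = (b, x)" by force
    have x: "x \<in> X" and w: "w \<in> words X" using Cons.prems l by auto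
    have "?c [(False, x)] \<otimes>\<^bsub>?P\<^esub> ?c [(True, x)] = ?c ([(False, x)] @ [(True, x)])"
      using x by (intro presented_group_mult) auto
    also have "\<dots> = ?c []"
      using word_rel.cancel[OF x, of False] by (intro equiv_class_eq[OF equiv_word_rel]) auto
    finally have "?c [(False, x)] = inv\<^bsub>?P\<^esub> ?c [(True, x)]"
      using x by (intro P.inv_equality[symmetric]) (auto simp: one carr)
    then have "f (?c [(False, x)]) = inv f (?c [(True, x)])"
      using x carr by simp
    then have letter: "f (?c [l]) = (if b then f (?c [(True, x)]) else inv f (?c [(True, x)]))"
      using l by simp
    have "?c (l # w) = ?c [l] \<otimes>\<^bsub>?P\<^esub> ?c w"
      using presented_group_mult[of "[l]" X w E] x w l by simp
    then have "f (?c (l # w)) = f (?c [l]) \<otimes> f (?c w)"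
      using carr x w l by simp
    then show ?case using letter Cons.IH w l by simp
  }
qed

text \<open>Von Dyck's theorem: a class is sent to the value of an arbitrarily chosen
  representative, which is well defined by \<open>word_val_rel\<close>.\<close>

lemma presented_group_hom_exists:
  assumes \<phi>: "\<phi> \<in> X \<rightarrow> carrier G"
    and rel: "\<And>u v. (u, v) \<in> E \<Longrightarrow> u \<in> words X \<Longrightarrow> v \<in> words X \<Longrightarrow> word_val G \<phi> u = word_val G \<phi> v"
  obtains f where "f \<in> hom (presented_group X E) G"
    "\<And>x. x \<in> X \<Longrightarrow> f (word_rel X E `` {[(True, x)]}) = \<phi> x"
proof -
  let ?P = "presented_group X E" and ?c = "\<lambda>w. word_rel X E `` {w}"
  define f where "f A = word_val G \<phi> (SOME w. w \<in> A)" for A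
  have f: "f (?c w) = word_val G \<phi> w" if "w \<in> words X" for w
  proof -
    have "w \<in> ?c w" using that by (auto intro: word_rel.refl)
    then have "(SOME u. u \<in> ?c w) \<in> ?c w" by (rule someI)
    then show ?thesis
      using word_val_rel[OF \<phi> rel] unfolding f_def by (metis Image_singleton_iff)
  qed
  have carr: "A \<in> carrier ?P \<longleftrightarrow> (\<exists>u\<in>words X. A = ?c u)" for A
    by (auto simp: presented_group_def quotient_def)
  have "f \<in> hom ?P G"
    by (rule homI)
      (auto simp: carr f presented_group_mult word_val_append[OF \<phi>] word_val_closed[OF \<phi>])
  moreover have "f (?c [(True, x)]) = \<phi> x" if "x \<in> X" for x
    using that f[of "[(True, x)]"] \<phi> by (auto simp: Pi_iff)
  ultimately show thesis by (rule that)
qed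

end


section \<open>Homomorphisms out of Steinberg groups\<close>

text \<open>The Steinberg relations read inside the target group. Such families correspond to
  homomorphisms out of the Steinberg group, so that later arguments need no words.\<close>

definition steinberg_family ::
    "('r, 'm) ring_scheme \<Rightarrow> ('g, 'z) monoid_scheme \<Rightarrow> ('n::finite \<Rightarrow> 'n \<Rightarrow> 'r \<Rightarrow> 'g) \<Rightarrow> bool" where
  "steinberg_family R H \<phi> \<longleftrightarrow>
     (\<forall>i j x. i \<noteq> j \<and> x \<in> carrier R \<longrightarrow> \<phi> i j x \<in> carrier H) \<and>
     (\<forall>i j x y. i \<noteq> j \<and> x \<in> carrier R \<and> y \<in> carrier R \<longrightarrow>
        \<phi> i j (x \<oplus>\<^bsub>R\<^esub> y) = \<phi> i j x \<otimes>\<^bsub>H\<^esub> \<phi> i j y) \<and>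
     (\<forall>i j k x y. i \<noteq> j \<and> j \<noteq> k \<and> i \<noteq> k \<and> x \<in> carrier R \<and> y \<in> carrier R \<longrightarrow>
        commutator H (\<phi> i j x) (\<phi> j k y) = \<phi> i k (x \<otimes>\<^bsub>R\<^esub> y)) \<and>
     (\<forall>i j k l x y. i \<noteq> j \<and> k \<noteq> l \<and> j \<noteq> k \<and> i \<noteq> l \<and> x \<in> carrier R \<and> y \<in> carrier R \<longrightarrow>
        commutator H (\<phi> i j x) (\<phi> k l y) = \<one>\<^bsub>H\<^esub>)"

lemma (in group) word_val_word_comm:
  assumes "\<phi> x \<in> carrier G" "\<phi> y \<in> carrier G"
  shows "word_val G \<phi> (word_comm [(True, x)] [(True, y)]) = commutator G (\<phi> x) (\<phi> y)"
  using assms by (simp add: word_comm_def word_inv_def commutator_def m_assoc)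

lemma (in group) steinberg_family_word_val:
  fixes \<phi> :: "'n::finite \<times> 'n \<times> 'r \<Rightarrow> 'a"
  assumes R: "ring R" and \<phi>: "\<phi> \<in> steinberg_gens R \<rightarrow> carrier G"
  shows "steinberg_family R G (\<lambda>i j x. \<phi> (i, j, x)) \<longleftrightarrow>
    (\<forall>(u, v) \<in> steinberg_rels R. word_val G \<phi> u = word_val G \<phi> v)" (is "?L \<longleftrightarrow> ?R")
proof -
  interpret R: ring R by (rule R)
  have c [simp]: "\<phi> (i, j, x) \<in> carrier G" if "i \<noteq> j" "x \<in> carrier R" for i j x
    using \<phi> that by (auto simp: steinberg_gens_def)
  show ?thesis
  proof
    assume L: ?L
    show ?R
      using L unfolding steinberg_rels_def
      by (auto simp: word_val_word_comm steinberg_family_def)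
  next
    assume R: ?R
    have 1: "\<phi> (i, j, x) \<otimes> \<phi> (i, j, y) = \<phi> (i, j, x \<oplus>\<^bsub>R\<^esub> y)"
      if "i \<noteq> j" "x \<in> carrier R" "y \<in> carrier R" for i j x y
    proof -
      have "(steinberg_letter i j x @ steinberg_letter i j y, steinberg_letter i j (x \<oplus>\<^bsub>R\<^esub> y))
          \<in> steinberg_rels R"
        unfolding steinberg_rels_def using that by blast
      from bspec[OF R this] show ?thesis using that by simp
    qed
    have 2: "commutator G (\<phi> (i, j, x)) (\<phi> (j, k, y)) = \<phi> (i, k, x \<otimes>\<^bsub>R\<^esub> y)"
      if "i \<noteq> j" "j \<noteq> k" "i \<noteq> k" "x \<in> carrier R" "y \<in> carrier R" for i j k x y
    proof -
      have "(word_comm (steinberg_letter i j x) (steinberg_letter j k y),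
          steinberg_letter i k (x \<otimes>\<^bsub>R\<^esub> y)) \<in> steinberg_rels R"
        unfolding steinberg_rels_def using that by blast
      from bspec[OF R this] show ?thesis using that by (simp add: word_val_word_comm)
    qed
    have 3: "commutator G (\<phi> (i, j, x)) (\<phi> (k, l, y)) = \<one>"
      if "i \<noteq> j" "k \<noteq> l" "j \<noteq> k" "i \<noteq> l" "x \<in> carrier R" "y \<in> carrier R" for i j k l x y
    proof -
      have "(word_comm (steinberg_letter i j x) (steinberg_letter k l y), []) \<in> steinberg_rels R"
        unfolding steinberg_rels_def using that by blast
      from bspec[OF R this] show ?thesis using that by (simp add: word_val_word_comm)
    qed
    show ?L
      unfolding steinberg_family_def using 1 2 3 by auto
  qed
qed

lemma (in group) steinberg_family_hom:
  fixes Q :: "('n::finite \<times> 'n \<times> 'r) word set \<Rightarrow> 'a"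
  assumes R: "ring R" and Q: "Q \<in> hom (steinberg R) G"
  shows "steinberg_family R G (\<lambda>i j x. Q (steinberg_elt R i j x))"
proof -
  let ?c = "\<lambda>w. word_rel (steinberg_gens R) (steinberg_rels R) `` {w}"
  let ?\<phi> = "\<lambda>g. Q (?c [(True, g)])"
  interpret R: ring R by (rule R)
  have \<phi>: "?\<phi> \<in> steinberg_gens R \<rightarrow> carrier G"
    using Q by (auto simp: hom_def steinberg_def presented_group_def quotient_def Pi_iff)
  have val: "word_val G ?\<phi> w = Q (?c w)" if "w \<in> words (steinberg_gens R)" for w
    using presented_group_hom_word_val[OF Q[unfolded steinberg_def] that] by simp
  have "word_val G ?\<phi> u = word_val G ?\<phi> v" if "(u, v) \<in> steinberg_rels R" for u v
  proof -
    have "u \<in> words (steinberg_gens R)" "v \<in> words (steinberg_gens R)"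
      using that
      by (auto simp: steinberg_rels_def word_comm_def word_inv_def steinberg_gens_def)
    moreover from this have "?c u = ?c v"
      using that by (intro equiv_class_eq[OF equiv_word_rel] word_rel.relation)
    ultimately show ?thesis using val[of u] val[of v] by simp
  qed
  then show ?thesis
    using steinberg_family_word_val[OF R \<phi>] unfolding steinberg_elt_def by blast
qed

lemma (in group) steinberg_hom_exists:
  fixes \<phi> :: "'n::finite \<Rightarrow> 'n \<Rightarrow> 'r \<Rightarrow> 'a"
  assumes R: "ring R" and \<phi>: "steinberg_family R G \<phi>"
  obtains Q where "Q \<in> hom (steinberg R) G"
    "\<And>i j x. i \<noteq> j \<Longrightarrow> x \<in> carrier R \<Longrightarrow> Q (steinberg_elt R i j x) = \<phi> i j x"
proof -
  let ?\<psi> = "\<lambda>(i, j, x). \<phi> i j x"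
  have \<psi>: "?\<psi> \<in> steinberg_gens R \<rightarrow> carrier G"
    using \<phi> by (auto simp: steinberg_gens_def steinberg_family_def)
  have "\<forall>(u, v) \<in> steinberg_rels R. word_val G ?\<psi> u = word_val G ?\<psi> v"
    using steinberg_family_word_val[OF R \<psi>] \<phi> by simp
  then have rel: "word_val G ?\<psi> u = word_val G ?\<psi> v" if "(u, v) \<in> steinberg_rels R" for u v
    using that by blast
  show thesis
  proof (rule presented_group_hom_exists[OF \<psi> rel])
    fix Q :: "('n \<times> 'n \<times> 'r) word set \<Rightarrow> 'a"
    assume "Q \<in> hom (presented_group (steinberg_gens R) (steinberg_rels R)) G"
      and Q: "\<And>g. g \<in> steinberg_gens R \<Longrightarrow>
        Q (word_rel (steinberg_gens R) (steinberg_rels R) `` {[(True, g)]}) = ?\<psi> g"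
    then have "Q \<in> hom (steinberg R) G" by (simp add: steinberg_def)
    moreover have "Q (steinberg_elt R i j x) = \<phi> i j x" if "i \<noteq> j" "x \<in> carrier R" for i j x
      using Q[of "(i, j, x)"] that by (simp add: steinberg_gens_def steinberg_elt_def)
    ultimately show thesis by (rule that)
  qed
qed

text \<open>Agreement on generators spreads to all words, and the classes of words make up the
  carrier; outside it the two functions may differ.\<close>

lemma (in group) steinberg_hom_unique:
  fixes Q Q' :: "('n::finite \<times> 'n \<times> 'r) word set \<Rightarrow> 'a"
  assumes "Q \<in> hom (steinberg R) G" "Q' \<in> hom (steinberg R) G"
    and "\<And>i j x. i \<noteq> j \<Longrightarrow> x \<in> carrier R \<Longrightarrow>
           Q (steinberg_elt R i j x) = Q' (steinberg_elt R i j x)"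
    and "A \<in> carrier (steinberg R)"
  shows "Q A = Q' A"
proof -
  let ?X = "steinberg_gens R" and ?E = "steinberg_rels R"
  obtain w where w: "w \<in> words ?X" "A = word_rel ?X ?E `` {w}"
    using assms(4) by (auto simp: steinberg_def presented_group_def quotient_def)
  have "word_val G (\<lambda>g. Q (word_rel ?X ?E `` {[(True, g)]})) w
      = word_val G (\<lambda>g. Q' (word_rel ?X ?E `` {[(True, g)]})) w"
    using w(1)
  proof (induction w)
    case (Cons l w)
    obtain b i j x where l: "l = (b, i, j, x)" by (metis prod.exhaust)
    then have "i \<noteq> j" "x \<in> carrier R" using Cons.prems by (auto simp: steinberg_gens_def)
    then show ?case using Cons l assms(3)[of i j x] by (simp add: steinberg_elt_def)
  qed simp
  then show ?thesis
    using presented_group_hom_word_val[OF assms(1)[unfolded steinberg_def] w(1)]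
      presented_group_hom_word_val[OF assms(2)[unfolded steinberg_def] w(1)] w(2) by simp
qed


section \<open>The root system of type A\<close>

lemma reflect_A_roots:
  fixes i j k :: "'n::finite"
  assumes "i \<noteq> j" "j \<noteq> k" "i \<noteq> k"
  shows "reflect (axis i 1 - axis j 1) (axis j 1 - axis k 1) = (axis i 1 - axis k 1 :: real ^ 'n)"
    and "reflect (axis i 1 - axis j 1) (axis k 1 - axis i 1) = (axis k 1 - axis j 1 :: real ^ 'n)"
  using assms by (simp_all add: reflect_def inner_diff_left inner_diff_right inner_axis_axis)

lemma independent_pair:
  fixes \<alpha> \<beta> :: "'v::real_vector"
  assumes "\<alpha> \<noteq> \<beta>" and "\<And>s t. s *\<^sub>R \<alpha> + t *\<^sub>R \<beta> = 0 \<Longrightarrow> s = 0 \<and> t = 0"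
  shows "independent {\<alpha>, \<beta>}"
  using assms by (auto simp: real_vector.dependent_finite)

text \<open>Unless the roots are equal or opposite, one of them has a nonzero coordinate where the
  other vanishes. Reading the relation at \<open>i\<close>, \<open>j\<close>, \<open>k\<close>,
  \<open>l\<close> is therefore enough.\<close>

lemma A_roots_independent:
  fixes i j k l :: "'n::finite"
  assumes "i \<noteq> j" "k \<noteq> l" "(k, l) \<noteq> (i, j)" "(k, l) \<noteq> (j, i)"
    and "s *\<^sub>R (axis i 1 - axis j 1) + t *\<^sub>R (axis k 1 - axis l 1) = (0 :: real ^ 'n)"
  shows "s = 0 \<and> t = 0"
proof -
  have eq: "s * ((if a = i then 1 else 0) - (if a = j then 1 else 0))
      + t * ((if a = k then 1 else 0) - (if a = l then 1 else 0)) = 0" for a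
  proof -
    have "(s *\<^sub>R (axis i 1 - axis j 1) + t *\<^sub>R (axis k 1 - axis l 1) :: real ^ 'n) $ a = 0"
      using assms(5) by simp
    then show ?thesis by (simp add: axis_def)
  qed
  show ?thesis
    using eq[of i] eq[of j] eq[of k] eq[of l] assms(1-4) by (auto split: if_splits)
qed

lemma A_roots_distinct:
  fixes i j k l :: "'n::finite"
  assumes "i \<noteq> j" "k \<noteq> l" "(k, l) \<noteq> (i, j)"
  shows "axis i 1 - axis j 1 \<noteq> (axis k 1 - axis l 1 :: real ^ 'n)"
proof
  assume eq: "axis i 1 - axis j 1 = (axis k 1 - axis l 1 :: real ^ 'n)"
  have "(if a = i then 1 else 0) - (if a = j then 1 else 0)
      = (if a = k then 1 else 0) - (if a = l then 1 else (0::real))" for a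
    using arg_cong[OF eq, of "\<lambda>v. v $ a"] by (simp add: axis_def)
  from this[of i] this[of j] show False
    using assms by (auto split: if_splits)
qed

lemma A_roots_independent_pair:
  fixes i j k l :: "'n::finite"
  assumes "i \<noteq> j" "k \<noteq> l" "(k, l) \<noteq> (i, j)" "(k, l) \<noteq> (j, i)"
  shows "independent {axis i 1 - axis j 1, axis k 1 - axis l 1 :: real ^ 'n}"
  by (rule independent_pair[OF A_roots_distinct A_roots_independent]) (use assms in auto)

text \<open>Turns membership in an interval into equations between coordinates, which case
  distinctions on indices can then decide.\<close>

lemma open_root_interval_A_rootsD:
  fixes i j k l :: "'n::finite"
  assumes "\<gamma> \<in> open_root_interval A_roots (axis i 1 - axis j 1) (axis k 1 - axis l 1 :: real ^ 'n)"
  obtains a b s t where "a \<noteq> b" "\<gamma> = axis a 1 - axis b 1" "s > 0" "t > (0::real)"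
    "\<forall>c. s * ((if c = i then 1 else 0) - (if c = j then 1 else 0))
      + t * ((if c = k then 1 else 0) - (if c = l then 1 else 0))
      = (if c = a then 1 else 0) - (if c = b then 1 else 0)"
proof -
  obtain a b s t where *: "a \<noteq> b" "\<gamma> = axis a 1 - axis b 1" "s > 0" "t > (0::real)"
      "\<gamma> = s *\<^sub>R (axis i 1 - axis j 1) + t *\<^sub>R (axis k 1 - axis l 1)"
    using assms by (auto simp: open_root_interval_def A_roots_def)
  have "s * ((if c = i then 1 else 0) - (if c = j then 1 else 0))
      + t * ((if c = k then 1 else 0) - (if c = l then 1 else 0))
      = (if c = a then 1 else 0) - (if c = b then 1 else 0)" for c
  proof -
    have "(s *\<^sub>R (axis i 1 - axis j 1) + t *\<^sub>R (axis k 1 - axis l 1) :: real ^ 'n) $ c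
        = (axis a 1 - axis b 1) $ c"
      using *(2,5) by simp
    then show ?thesis by (simp add: axis_def)
  qed
  with * show thesis using that by blast
qed

text \<open>The only positive coordinate of a root \<open>axis a 1 - axis b 1\<close> is at
  \<open>a\<close> and the only negative one at \<open>b\<close>. A positive combination has
  coordinate \<open>s\<close> at \<open>i\<close> and \<open>- t\<close> at \<open>k\<close>, hence
  \<open>a = i\<close> and \<open>b = k\<close>.\<close>

lemma open_root_interval_A_roots_adjacent:
  fixes i j k :: "'n::finite"
  assumes "i \<noteq> j" "j \<noteq> k" "i \<noteq> k"
  shows "open_root_interval A_roots (axis i 1 - axis j 1) (axis j 1 - axis k 1)
    \<subseteq> {axis i 1 - axis k 1 :: real ^ 'n}"
proof
  fix \<gamma> assume "\<gamma> \<in> open_root_interval A_roots (axis i 1 - axis j 1) (axis j 1 - axis k 1 :: real ^ 'n)"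
  then obtain a b s t where *: "a \<noteq> b" "\<gamma> = axis a 1 - axis b 1" "s > 0" "t > (0::real)"
    "\<forall>c. s * ((if c = i then 1 else 0) - (if c = j then 1 else 0))
      + t * ((if c = j then 1 else 0) - (if c = k then 1 else 0))
      = (if c = a then 1 else 0) - (if c = b then 1 else 0)"
    using open_root_interval_A_rootsD by blast
  have "a = i" using *(5)[rule_format, of i] *(1,3,4) assms by (auto split: if_splits)
  moreover have "b = k" using *(5)[rule_format, of k] *(1,3,4) assms by (auto split: if_splits)
  ultimately show "\<gamma> \<in> {axis i 1 - axis k 1}" using * by simp
qed

text \<open>Without cancellation, a positive combination is positive at both \<open>i\<close> and
  \<open>k\<close> and negative at both \<open>j\<close> and \<open>l\<close>. For a root this
  forces \<open>i = k\<close> and \<open>j = l\<close>.\<close>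

lemma open_root_interval_A_roots_disjoint:
  fixes i j k l :: "'n::finite"
  assumes "i \<noteq> j" "k \<noteq> l" "j \<noteq> k" "i \<noteq> l" "(k, l) \<noteq> (i, j)"
  shows "open_root_interval A_roots (axis i 1 - axis j 1) (axis k 1 - axis l 1 :: real ^ 'n) = {}"
proof (rule ccontr)
  assume "open_root_interval A_roots (axis i 1 - axis j 1) (axis k 1 - axis l 1 :: real ^ 'n) \<noteq> {}"
  then obtain \<gamma> where
    "\<gamma> \<in> open_root_interval A_roots (axis i 1 - axis j 1) (axis k 1 - axis l 1 :: real ^ 'n)"
    by blast
  then obtain a b s t where *: "a \<noteq> b" "\<gamma> = axis a 1 - axis b 1" "s > 0" "t > (0::real)"
    "\<forall>c. s * ((if c = i then 1 else 0) - (if c = j then 1 else 0))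
      + t * ((if c = k then 1 else 0) - (if c = l then 1 else 0))
      = (if c = a then 1 else 0) - (if c = b then 1 else 0)"
    using open_root_interval_A_rootsD by blast
  have "a = i" "a = k"
    using *(5)[rule_format, of i] *(5)[rule_format, of k] *(1,3,4) assms by (auto split: if_splits)
  moreover have "b = j" "b = l"
    using *(5)[rule_format, of j] *(5)[rule_format, of l] *(1,3,4) assms by (auto split: if_splits)
  ultimately show False using assms(5) by simp
qed

text \<open>The cone spanned by two independent roots is the one to which the axiom on trivial
  intersections will be applied; independence makes it pointed and makes the ray of \<alpha> a
  face.\<close>

lemma extreme_in_generated_cone:
  fixes \<alpha> \<beta> :: "'v::euclidean_space"
  assumes \<Phi>: "\<alpha> \<in> \<Phi>" "\<beta> \<in> \<Phi>" and "\<alpha> \<noteq> \<beta>"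
    and ind: "\<And>s t. s *\<^sub>R \<alpha> + t *\<^sub>R \<beta> = 0 \<Longrightarrow> s = 0 \<and> t = 0"
  defines "C \<equiv> {s *\<^sub>R \<alpha> + t *\<^sub>R \<beta> | s t. s \<ge> 0 \<and> t \<ge> 0}"
  shows "special_closed \<Phi> (\<Phi> \<inter> C)" and "extreme_in (\<Phi> \<inter> C) \<alpha>"
proof -
  have mem: "s *\<^sub>R \<alpha> + t *\<^sub>R \<beta> \<in> C" if "s \<ge> 0" "t \<ge> 0" for s t
    using that by (auto simp: C_def)
  have uniq: "s = s' \<and> t = t'" if "s *\<^sub>R \<alpha> + t *\<^sub>R \<beta> = s' *\<^sub>R \<alpha> + t' *\<^sub>R \<beta>" for s s' t t'
  proof -
    have "(s - s') *\<^sub>R \<alpha> + (t - t') *\<^sub>R \<beta> = 0"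
      using that by (simp add: algebra_simps)
    then show ?thesis using ind[of "s - s'" "t - t'"] by simp
  qed
  have C: "convex_cone C"
    unfolding convex_cone_iff
  proof (intro conjI ballI allI impI)
    show "0 \<in> C" using mem[of 0 0] by simp
  next
    fix x y assume "x \<in> C" "y \<in> C"
    then obtain s t s' t' where
      "x = s *\<^sub>R \<alpha> + t *\<^sub>R \<beta>" "y = s' *\<^sub>R \<alpha> + t' *\<^sub>R \<beta>" "s \<ge> 0" "t \<ge> 0" "s' \<ge> 0" "t' \<ge> 0"
      by (auto simp: C_def)
    then show "x + y \<in> C" using mem[of "s + s'" "t + t'"] by (simp add: algebra_simps)
  next
    fix x and c :: real assume "x \<in> C" "c \<ge> 0"
    then obtain s t where "x = s *\<^sub>R \<alpha> + t *\<^sub>R \<beta>" "s \<ge> 0" "t \<ge> 0"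
      by (auto simp: C_def)
    then show "c *\<^sub>R x \<in> C" using mem[of "c * s" "c * t"] \<open>c \<ge> 0\<close> by (simp add: algebra_simps)
  qed
  have "v = 0" if v: "v \<in> C" "- v \<in> C" for v
  proof -
    obtain s t s' t' where st: "v = s *\<^sub>R \<alpha> + t *\<^sub>R \<beta>" "- v = s' *\<^sub>R \<alpha> + t' *\<^sub>R \<beta>"
      "s \<ge> 0" "t \<ge> 0" "s' \<ge> 0" "t' \<ge> 0"
      using v unfolding C_def by blast
    have "(s + s') *\<^sub>R \<alpha> + (t + t') *\<^sub>R \<beta> = v + - v"
      by (simp only: st(2), subst st(1)) (simp add: algebra_simps)
    then have "s + s' = 0 \<and> t + t' = 0" using ind by simp
    then have "s = 0" "t = 0" using st by auto
    then show "v = 0" using st(1) by simp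
  qed
  with C show "special_closed \<Phi> (\<Phi> \<inter> C)"
    unfolding special_closed_def by blast
  have \<alpha>: "\<alpha> \<in> C" using mem[of 1 0] by simp
  have \<beta>: "\<beta> \<in> C" using mem[of 0 1] by simp
  have hull: "convex_cone hull (\<Phi> \<inter> C) = C"
  proof (rule hull_unique)
    fix D assume D: "\<Phi> \<inter> C \<subseteq> D" "convex_cone D"
    then have "\<alpha> \<in> D" "\<beta> \<in> D" using \<alpha> \<beta> \<Phi> by auto
    then show "C \<subseteq> D"
      using D(2) by (auto simp: C_def intro!: convex_cone_add convex_cone_scaleR)
  qed (use C in auto)
  let ?r = "{c *\<^sub>R \<alpha> | c. c \<ge> 0}"
  have "?r face_of C"
    unfolding face_of_def
  proof (intro conjI ballI impI)
    show "?r \<subseteq> C" using mem[of _ 0] by auto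
    show "convex ?r"
      by (auto simp: convex_def simp flip: scaleR_left_distrib intro!: exI[of _ "_ * _ + _ * _"])
  next
    fix a b x assume "a \<in> C" "b \<in> C" "x \<in> ?r" and seg: "x \<in> open_segment a b"
    then obtain s t s' t' c where
      ab: "a = s *\<^sub>R \<alpha> + t *\<^sub>R \<beta>" "b = s' *\<^sub>R \<alpha> + t' *\<^sub>R \<beta>" "s \<ge> 0" "t \<ge> 0" "s' \<ge> 0" "t' \<ge> 0"
      and x: "x = c *\<^sub>R \<alpha>"
      unfolding C_def by blast
    obtain u where u: "0 < u" "u < 1" "x = (1 - u) *\<^sub>R a + u *\<^sub>R b"
      using seg by (auto simp: in_segment)
    \<comment> \<open>On the ray the \<beta>-coordinate vanishes. It is a positive combination of
      the nonnegative \<beta>-coordinates of the two endpoints, so these vanish as well.\<close>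
    have "((1 - u) * s + u * s') *\<^sub>R \<alpha> + ((1 - u) * t + u * t') *\<^sub>R \<beta> = c *\<^sub>R \<alpha> + 0 *\<^sub>R \<beta>"
      using u(3) x ab(1,2) by (simp add: algebra_simps)
    then have "(1 - u) * t + u * t' = 0" using uniq by blast
    moreover have "(1 - u) * t \<ge> 0" "u * t' \<ge> 0" using u ab by auto
    ultimately have "(1 - u) * t = 0" "u * t' = 0" by linarith+
    then have "t = 0" "t' = 0" using u by auto
    then show "a \<in> ?r" "b \<in> ?r" using ab by auto
  qed
  moreover have "\<alpha> \<noteq> 0" using ind[of 1 0] by auto
  ultimately have "extreme_ray_of ?r (convex_cone hull (\<Phi> \<inter> C))"
    unfolding extreme_ray_of_def hull by blast
  moreover have "\<alpha> \<in> ?r" by (auto intro: exI[of _ 1])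
  ultimately show "extreme_in (\<Phi> \<inter> C) \<alpha>"
    unfolding extreme_in_def using \<alpha> \<Phi> by blast
qed

text \<open>In the cone spanned by both roots, \<beta> survives the removal of \<alpha>, so its root
  subgroup lies in the group that the axiom separates from that of \<alpha>.\<close>

lemma root_subgroups_Int_trivial:
  fixes \<alpha> \<beta> :: "'v::euclidean_space"
  assumes "has_commutator_relations \<Phi> G Gs" "\<alpha> \<in> \<Phi>" "\<beta> \<in> \<Phi>" "\<alpha> \<noteq> \<beta>"
    and ind: "\<And>s t. s *\<^sub>R \<alpha> + t *\<^sub>R \<beta> = 0 \<Longrightarrow> s = 0 \<and> t = 0"
  shows "Gs \<alpha> \<inter> Gs \<beta> \<subseteq> {\<one>\<^bsub>G\<^esub>}"
proof -
  let ?\<Sigma> = "\<Phi> \<inter> {s *\<^sub>R \<alpha> + t *\<^sub>R \<beta> | s t. s \<ge> 0 \<and> t \<ge> 0}"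
  have "Gs \<alpha> \<inter> generate G (\<Union>\<gamma>\<in>?\<Sigma> - {\<alpha>}. Gs \<gamma>) = {\<one>\<^bsub>G\<^esub>}"
    using assms(1) extreme_in_generated_cone[OF assms(2-4) ind]
    unfolding has_commutator_relations_def by blast
  moreover have "\<beta> = 0 *\<^sub>R \<alpha> + 1 *\<^sub>R \<beta> \<and> (0::real) \<le> 0 \<and> (0::real) \<le> 1" by simp
  then have "\<beta> \<in> ?\<Sigma> - {\<alpha>}" using assms(3,4) by blast
  then have "Gs \<beta> \<subseteq> generate G (\<Union>\<gamma>\<in>?\<Sigma> - {\<alpha>}. Gs \<gamma>)" by (auto intro: generate.incl)
  ultimately show ?thesis by blast
qed


section \<open>Graded groups of type A\<close>

text \<open>The consequences of the grading in terms of index pairs. The case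
  \<open>(k, l) = (i, j)\<close> is left out of \<open>commutator_trivial\<close> because the axioms
  say nothing about a root paired with itself; \<open>X_abelian\<close> supplies it. Of the action
  of a Weyl element only its effect on \<open>X j k\<close> and \<open>X k i\<close> for a third
  index \<open>k\<close> is recorded.\<close>

locale A_graded = group G for G :: "('a, 'z) monoid_scheme" (structure) +
  fixes X :: "'n::finite \<Rightarrow> 'n \<Rightarrow> 'a set"
  assumes card_index: "4 \<le> CARD('n)"
    and subgroup_X: "i \<noteq> j \<Longrightarrow> subgroup (X i j) G"
    and commutator_X:
      "\<lbrakk>i \<noteq> j; j \<noteq> k; i \<noteq> k; x \<in> X i j; y \<in> X j k\<rbrakk> \<Longrightarrow> commutator G x y \<in> X i k"
    and commutator_trivial:
      "\<lbrakk>i \<noteq> j; k \<noteq> l; j \<noteq> k; i \<noteq> l; (k, l) \<noteq> (i, j); x \<in> X i j; y \<in> X k l\<rbrakk>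
        \<Longrightarrow> commutator G x y = \<one>"
    and Int_trivial_row: "\<lbrakk>i \<noteq> j; j \<noteq> k; i \<noteq> k\<rbrakk> \<Longrightarrow> X i j \<inter> X i k \<subseteq> {\<one>}"
    and Int_trivial_column: "\<lbrakk>i \<noteq> j; j \<noteq> k; i \<noteq> k\<rbrakk> \<Longrightarrow> X i k \<inter> X j k \<subseteq> {\<one>}"
    and Weyl_exists: "i \<noteq> j \<Longrightarrow> \<exists>a\<in>X i j. \<exists>b\<in>X j i. \<exists>c\<in>X i j. \<forall>k. k \<noteq> i \<and> k \<noteq> j \<longrightarrow>
        (\<lambda>g. (a \<otimes> b \<otimes> c) \<otimes> g \<otimes> inv (a \<otimes> b \<otimes> c)) ` X j k = X i k \<and>
        (\<lambda>g. (a \<otimes> b \<otimes> c) \<otimes> g \<otimes> inv (a \<otimes> b \<otimes> c)) ` X k i = X k j"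

lemma graded_group_A_graded:
  fixes Gs :: "real ^ 'n::finite \<Rightarrow> 'g set"
  assumes "graded_group A_roots G Gs" and "4 \<le> CARD('n)"
  shows "A_graded G (\<lambda>i j. Gs (axis i 1 - axis j 1))"
proof -
  let ?r = "\<lambda>i j :: 'n. axis i 1 - axis j 1 :: real ^ 'n"
  interpret group G using assms by (simp add: graded_group_def)
  have rel: "has_commutator_relations A_roots G Gs" using assms by (simp add: graded_group_def)
  have root: "?r i j \<in> A_roots" if "i \<noteq> j" for i j
    using that by (auto simp: A_roots_def)
  have sub: "subgroup (Gs (?r i j)) G" if "i \<noteq> j" for i j
    using rel root[OF that] by (simp add: has_commutator_relations_def)
  have comm: "commutator G x y \<in> generate G (\<Union>\<gamma>\<in>open_root_interval A_roots (?r i j) (?r k l). Gs \<gamma>)"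
    if "i \<noteq> j" "k \<noteq> l" "(k, l) \<noteq> (i, j)" "(k, l) \<noteq> (j, i)" "x \<in> Gs (?r i j)" "y \<in> Gs (?r k l)"
    for i j k l x y
  proof -
    have "commutator G x y \<in> commutator_subgroup G (Gs (?r i j)) (Gs (?r k l))"
      unfolding commutator_subgroup_def using that by (auto intro: generate.incl)
    moreover have "commutator_subgroup G (Gs (?r i j)) (Gs (?r k l))
        \<subseteq> generate G (\<Union>\<gamma>\<in>open_root_interval A_roots (?r i j) (?r k l). Gs \<gamma>)"
      using rel root[OF that(1)] root[OF that(2)] A_roots_distinct[OF that(1-3)]
        A_roots_independent_pair[OF that(1-4)]
      unfolding has_commutator_relations_def by blast
    ultimately show ?thesis by blast
  qed
  have int: "Gs (?r i j) \<inter> Gs (?r k l) \<subseteq> {\<one>\<^bsub>G\<^esub>}"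
    if "i \<noteq> j" "k \<noteq> l" "(k, l) \<noteq> (i, j)" "(k, l) \<noteq> (j, i)" for i j k l
    using root_subgroups_Int_trivial[OF rel root[OF that(1)] root[OF that(2)]
        A_roots_distinct[OF that(1-3)] A_roots_independent[OF that(1-4)]] .
  show ?thesis
  proof (rule A_graded.intro[OF is_group A_graded_axioms.intro])
    show "4 \<le> CARD('n)" by (rule assms(2))
  next
    fix i j :: 'n assume ij: "i \<noteq> j"
    then show "subgroup (Gs (?r i j)) G" by (rule sub)
    obtain n where n: "Weyl_element A_roots G Gs (?r i j) n"
      using assms root[OF ij] unfolding graded_group_def by blast
    have "- ?r i j = ?r j i" by simp
    with n obtain a b c where abc: "a \<in> Gs (?r i j)" "b \<in> Gs (?r j i)" "c \<in> Gs (?r i j)"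
      "n = a \<otimes>\<^bsub>G\<^esub> b \<otimes>\<^bsub>G\<^esub> c"
      unfolding Weyl_element_def set_mult_def by auto
    have act: "(\<lambda>g. n \<otimes>\<^bsub>G\<^esub> g \<otimes>\<^bsub>G\<^esub> inv\<^bsub>G\<^esub> n) ` Gs \<beta> = Gs (reflect (?r i j) \<beta>)" if "\<beta> \<in> A_roots" for \<beta>
      using n that unfolding Weyl_element_def by blast
    have "\<forall>k. k \<noteq> i \<and> k \<noteq> j \<longrightarrow>
        (\<lambda>g. n \<otimes>\<^bsub>G\<^esub> g \<otimes>\<^bsub>G\<^esub> inv\<^bsub>G\<^esub> n) ` Gs (?r j k) = Gs (?r i k) \<and>
        (\<lambda>g. n \<otimes>\<^bsub>G\<^esub> g \<otimes>\<^bsub>G\<^esub> inv\<^bsub>G\<^esub> n) ` Gs (?r k i) = Gs (?r k j)"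
    proof (intro allI impI)
      fix k assume k: "k \<noteq> i \<and> k \<noteq> j"
      show "(\<lambda>g. n \<otimes>\<^bsub>G\<^esub> g \<otimes>\<^bsub>G\<^esub> inv\<^bsub>G\<^esub> n) ` Gs (?r j k) = Gs (?r i k) \<and>
        (\<lambda>g. n \<otimes>\<^bsub>G\<^esub> g \<otimes>\<^bsub>G\<^esub> inv\<^bsub>G\<^esub> n) ` Gs (?r k i) = Gs (?r k j)"
        using act[OF root, of j k] act[OF root, of k i] reflect_A_roots[of i j k] ij k by metis
    qed
    then show "\<exists>a\<in>Gs (?r i j). \<exists>b\<in>Gs (?r j i). \<exists>c\<in>Gs (?r i j). \<forall>k. k \<noteq> i \<and> k \<noteq> j \<longrightarrow>
        (\<lambda>g. (a \<otimes>\<^bsub>G\<^esub> b \<otimes>\<^bsub>G\<^esub> c) \<otimes>\<^bsub>G\<^esub> g \<otimes>\<^bsub>G\<^esub> inv\<^bsub>G\<^esub> (a \<otimes>\<^bsub>G\<^esub> b \<otimes>\<^bsub>G\<^esub> c)) ` Gs (?r j k) = Gs (?r i k) \<and>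
        (\<lambda>g. (a \<otimes>\<^bsub>G\<^esub> b \<otimes>\<^bsub>G\<^esub> c) \<otimes>\<^bsub>G\<^esub> g \<otimes>\<^bsub>G\<^esub> inv\<^bsub>G\<^esub> (a \<otimes>\<^bsub>G\<^esub> b \<otimes>\<^bsub>G\<^esub> c)) ` Gs (?r k i) = Gs (?r k j)"
      using abc by blast
  next
    fix i j k :: 'n and x y assume ijk: "i \<noteq> j" "j \<noteq> k" "i \<noteq> k" and "x \<in> Gs (?r i j)" "y \<in> Gs (?r j k)"
    then have "commutator G x y \<in> generate G (\<Union>\<gamma>\<in>open_root_interval A_roots (?r i j) (?r j k). Gs \<gamma>)"
      by (intro comm) auto
    also have "\<dots> \<subseteq> generate G (Gs (?r i k))"
      using open_root_interval_A_roots_adjacent[OF ijk] by (intro mono_generate) blast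
    also have "\<dots> \<subseteq> Gs (?r i k)" using sub ijk by (simp add: generate_subgroup_incl)
    finally show "commutator G x y \<in> Gs (?r i k)" .
  next
    fix i j k l :: 'n and x y
    assume "i \<noteq> j" "k \<noteq> l" "j \<noteq> k" "i \<noteq> l" "(k, l) \<noteq> (i, j)" "x \<in> Gs (?r i j)" "y \<in> Gs (?r k l)"
    then show "commutator G x y = \<one>\<^bsub>G\<^esub>"
      using comm[of i j k l x y] open_root_interval_A_roots_disjoint[of i j k l]
      by (simp add: generate_empty)
  next
    fix i j k :: 'n assume "i \<noteq> j" "j \<noteq> k" "i \<noteq> k"
    then show "Gs (?r i j) \<inter> Gs (?r i k) \<subseteq> {\<one>\<^bsub>G\<^esub>}" "Gs (?r i k) \<inter> Gs (?r j k) \<subseteq> {\<one>\<^bsub>G\<^esub>}"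
      using int[of i j i k] int[of i k j k] by auto
  qed
qed


section \<open>Commutator calculus\<close>

context group
begin

lemma commutator_closed [simp]:
  "\<lbrakk>x \<in> carrier G; y \<in> carrier G\<rbrakk> \<Longrightarrow> commutator G x y \<in> carrier G"
  by (simp add: commutator_def)

lemma commutator_eq_one_iff:
  assumes "x \<in> carrier G" "y \<in> carrier G"
  shows "commutator G x y = \<one> \<longleftrightarrow> x \<otimes> y = y \<otimes> x"
proof -
  have "commutator G x y = (x \<otimes> y) \<otimes> inv (y \<otimes> x)"
    using assms by (simp add: commutator_def inv_mult_group m_assoc)
  then show ?thesis
    using assms by (metis inv_equality inv_inv m_closed r_inv inv_closed)
qed

lemma conjugate_eq_commutator:
  "\<lbrakk>x \<in> carrier G; y \<in> carrier G\<rbrakk> \<Longrightarrow> x \<otimes> y \<otimes> inv x = commutator G x y \<otimes> y"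
  by (simp add: commutator_def m_assoc)

lemma inv_commutator:
  "\<lbrakk>x \<in> carrier G; y \<in> carrier G\<rbrakk> \<Longrightarrow> inv (commutator G x y) = commutator G y x"
  by (simp add: commutator_def inv_mult_group m_assoc)

lemma inv_cancel_left [simp]:
  assumes "x \<in> carrier G" "y \<in> carrier G"
  shows "inv x \<otimes> (x \<otimes> y) = y" "x \<otimes> (inv x \<otimes> y) = y"
  using assms by (simp_all flip: m_assoc)

lemma conjugate_fixed:
  assumes "x \<in> carrier G" "y \<in> carrier G" "x \<otimes> y = y \<otimes> x"
  shows "x \<otimes> y \<otimes> inv x = y"
  using assms by (simp add: m_assoc)

lemma conjugate_mult:
  assumes "x \<in> carrier G" "y \<in> carrier G" "z \<in> carrier G"
  shows "x \<otimes> (y \<otimes> z) \<otimes> inv x = (x \<otimes> y \<otimes> inv x) \<otimes> (x \<otimes> z \<otimes> inv x)"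
  using assms by (simp add: m_assoc)

lemma commutator_mult_left:
  assumes [simp]: "x \<in> carrier G" "y \<in> carrier G" "z \<in> carrier G"
  shows "commutator G (x \<otimes> y) z = (x \<otimes> commutator G y z \<otimes> inv x) \<otimes> commutator G x z"
  by (simp add: commutator_def inv_mult_group m_assoc)

lemma commutator_mult_right:
  assumes [simp]: "x \<in> carrier G" "y \<in> carrier G" "z \<in> carrier G"
  shows "commutator G x (y \<otimes> z) = commutator G x y \<otimes> (y \<otimes> commutator G x z \<otimes> inv y)"
  by (simp add: commutator_def inv_mult_group m_assoc)

lemma commutator_one_left [simp]: "x \<in> carrier G \<Longrightarrow> commutator G \<one> x = \<one>"
  by (simp add: commutator_def)

lemma commutator_one_right [simp]: "x \<in> carrier G \<Longrightarrow> commutator G x \<one> = \<one>"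
  by (simp add: commutator_def)

lemma commute_inv:
  assumes "t \<in> carrier G" "x \<in> carrier G" "t \<otimes> x = x \<otimes> t"
  shows "t \<otimes> inv x = inv x \<otimes> t"
proof -
  have "inv x \<otimes> (t \<otimes> x) \<otimes> inv x = inv x \<otimes> (x \<otimes> t) \<otimes> inv x" using assms(3) by simp
  then show ?thesis using assms(1,2) by (simp add: m_assoc)
qed

lemma commute_mult:
  assumes "t \<in> carrier G" "x \<in> carrier G" "y \<in> carrier G" "t \<otimes> x = x \<otimes> t" "t \<otimes> y = y \<otimes> t"
  shows "t \<otimes> (x \<otimes> y) = x \<otimes> y \<otimes> t"
  using assms by (metis m_assoc)

lemma commute_commutator:
  assumes "t \<in> carrier G" "x \<in> carrier G" "y \<in> carrier G" "t \<otimes> x = x \<otimes> t" "t \<otimes> y = y \<otimes> t"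
  shows "t \<otimes> commutator G x y = commutator G x y \<otimes> t"
  unfolding commutator_def using assms by (intro commute_mult commute_inv) auto

lemma conjugate_conjugate:
  assumes "a \<in> carrier G" "b \<in> carrier G" "c \<in> carrier G" "g \<in> carrier G"
  shows "(a \<otimes> b \<otimes> c) \<otimes> g \<otimes> inv (a \<otimes> b \<otimes> c)
    = a \<otimes> (b \<otimes> (c \<otimes> g \<otimes> inv c) \<otimes> inv b) \<otimes> inv a"
  using assms by (simp add: m_assoc inv_mult_group)

text \<open>
  Conjugation by \<open>a \<otimes> b \<otimes> c\<close> maps \<open>A\<close> into \<open>B\<close>; the \<open>A\<close>-component of the result of applying
  \<open>c\<close>, \<open>b\<close>, \<open>a\<close> in turn must therefore vanish.
\<close>

lemma Weyl_triple:
  assumes A: "subgroup A G" and B: "subgroup B G" and AB: "A \<inter> B \<subseteq> {\<one>}"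
    and comm: "\<And>x y. x \<in> A \<Longrightarrow> y \<in> B \<Longrightarrow> x \<otimes> y = y \<otimes> x"
    and abc: "a \<in> carrier G" "b \<in> carrier G" "c \<in> carrier G"
    and aA: "\<And>x. x \<in> A \<Longrightarrow> commutator G a x \<in> B"
    and cA: "\<And>x. x \<in> A \<Longrightarrow> commutator G c x \<in> B"
    and bB: "\<And>y. y \<in> B \<Longrightarrow> commutator G b y \<in> A"
    and bA: "\<And>x. x \<in> A \<Longrightarrow> b \<otimes> x = x \<otimes> b"
    and aB: "\<And>y. y \<in> B \<Longrightarrow> a \<otimes> y = y \<otimes> a"
    and g: "g \<in> A" and n: "(a \<otimes> b \<otimes> c) \<otimes> g \<otimes> inv (a \<otimes> b \<otimes> c) \<in> B"
  shows "commutator G b (commutator G c g) = inv g"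
    and "(a \<otimes> b \<otimes> c) \<otimes> g \<otimes> inv (a \<otimes> b \<otimes> c)
      = inv (commutator G a g) \<otimes> (commutator G c g \<otimes> commutator G a g)"
proof -
  have carr [simp]: "x \<in> A \<Longrightarrow> x \<in> carrier G" "x \<in> B \<Longrightarrow> x \<in> carrier G" for x
    using subgroup.mem_carrier[OF A] subgroup.mem_carrier[OF B] by auto
  note [simp] = abc g
  define y z w v where "y = commutator G c g" and "z = commutator G b y"
    and "w = commutator G a z" and "v = commutator G a g"
  have mem [simp]: "y \<in> B" "z \<in> A" "w \<in> B" "v \<in> B"
    unfolding w_def v_def y_def z_def using g by (simp_all add: aA bB cA)
  have bg: "b \<otimes> g \<otimes> inv b = g" by (rule conjugate_fixed) (auto intro: bA)
  have ay: "a \<otimes> y \<otimes> inv a = y" by (rule conjugate_fixed) (auto intro: aB)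
  have zv: "z \<otimes> v \<otimes> inv z = v" by (rule conjugate_fixed) (auto intro: comm)
  have "(a \<otimes> b \<otimes> c) \<otimes> g \<otimes> inv (a \<otimes> b \<otimes> c) = a \<otimes> (b \<otimes> (y \<otimes> g) \<otimes> inv b) \<otimes> inv a"
    by (simp add: conjugate_conjugate conjugate_eq_commutator[of c] y_def)
  also have "b \<otimes> (y \<otimes> g) \<otimes> inv b = (b \<otimes> y \<otimes> inv b) \<otimes> (b \<otimes> g \<otimes> inv b)"
    using g by (intro conjugate_mult) auto
  also have "\<dots> = z \<otimes> y \<otimes> g"
    using g by (simp add: conjugate_eq_commutator[of b y] bg flip: z_def)
  also have "a \<otimes> (z \<otimes> y \<otimes> g) \<otimes> inv a
      = (a \<otimes> z \<otimes> inv a) \<otimes> (a \<otimes> y \<otimes> inv a) \<otimes> (a \<otimes> g \<otimes> inv a)"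
    using g by (simp only: conjugate_mult m_closed carr mem abc)
  also have "\<dots> = (w \<otimes> z) \<otimes> y \<otimes> (v \<otimes> g)"
    using g by (simp add: conjugate_eq_commutator[of a z] conjugate_eq_commutator[of a g] ay
        flip: w_def v_def)
  also have "\<dots> = w \<otimes> (z \<otimes> (y \<otimes> v)) \<otimes> g"
    by (simp add: m_assoc)
  also have "z \<otimes> (y \<otimes> v) = (y \<otimes> v) \<otimes> z"
    by (intro comm) (simp_all add: subgroup.m_closed[OF B])
  also have "w \<otimes> (y \<otimes> v \<otimes> z) \<otimes> g = (w \<otimes> (y \<otimes> v)) \<otimes> (z \<otimes> g)"
    by (simp add: m_assoc)
  finally have eq: "(a \<otimes> b \<otimes> c) \<otimes> g \<otimes> inv (a \<otimes> b \<otimes> c) = (w \<otimes> (y \<otimes> v)) \<otimes> (z \<otimes> g)" .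
  have wyv: "w \<otimes> (y \<otimes> v) \<in> B" and zg: "z \<otimes> g \<in> A"
    using g by (simp_all add: subgroup.m_closed[OF A] subgroup.m_closed[OF B])
  have "inv (w \<otimes> (y \<otimes> v)) \<otimes> ((a \<otimes> b \<otimes> c) \<otimes> g \<otimes> inv (a \<otimes> b \<otimes> c)) \<in> B"
    using wyv n by (rule subgroup.m_closed[OF B subgroup.m_inv_closed[OF B]])
  then have "z \<otimes> g \<in> B"
    unfolding eq using wyv zg by simp
  then have zg1: "z \<otimes> g = \<one>" using zg AB by blast
  then have z: "z = inv g" by (simp add: inv_equality)
  then show "commutator G b (commutator G c g) = inv g" by (simp add: z_def y_def)
  \<comment> \<open>Expanding the commutator of \<open>a\<close> with the trivial product expresses
    \<open>w\<close> through \<open>v\<close> and so eliminates \<open>z\<close> from the formula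
    for the conjugate.\<close>
  have "\<one> = commutator G a (z \<otimes> g)" by (simp add: zg1)
  also have "\<dots> = w \<otimes> v"
    by (simp add: commutator_mult_right zv flip: w_def v_def)
  finally have "w = inv v" by (simp add: inv_equality)
  then show "(a \<otimes> b \<otimes> c) \<otimes> g \<otimes> inv (a \<otimes> b \<otimes> c)
      = inv (commutator G a g) \<otimes> (commutator G c g \<otimes> commutator G a g)"
    unfolding eq by (simp add: zg1 flip: y_def v_def)
qed

end

section \<open>Weyl elements and commutativity of the root subgroups\<close>

context A_graded
begin

abbreviation comm_prod (infixl \<open>\<star>\<close> 75) where "x \<star> y \<equiv> commutator G x y"

lemma X_carrier [simp]: "x \<in> X i j \<Longrightarrow> i \<noteq> j \<Longrightarrow> x \<in> carrier G"
  using subgroup_X subgroup.mem_carrier by metis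

lemma X_mult [simp]: "x \<in> X i j \<Longrightarrow> y \<in> X i j \<Longrightarrow> i \<noteq> j \<Longrightarrow> x \<otimes> y \<in> X i j"
  by (metis subgroup_X subgroup.m_closed)

lemma X_inv [simp]: "x \<in> X i j \<Longrightarrow> i \<noteq> j \<Longrightarrow> inv x \<in> X i j"
  by (metis subgroup_X subgroup.m_inv_closed)

lemma X_one [simp]: "i \<noteq> j \<Longrightarrow> \<one> \<in> X i j"
  by (metis subgroup_X subgroup.one_closed)

text \<open>The bound on the rank is used through this lemma: with four indices, any three can be
  avoided.\<close>

lemma fresh_index:
  obtains m where "m \<noteq> i" "m \<noteq> j" "m \<noteq> (k :: 'n)"
proof -
  have "card {i, j, k} \<le> 3" by (simp add: card_insert_if)
  then have "{i, j, k} \<noteq> UNIV" using card_index by (intro notI) simp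
  then show thesis using that by blast
qed

lemma X_commute_distinct:
  assumes "i \<noteq> j" "k \<noteq> l" "j \<noteq> k" "i \<noteq> l" "(k, l) \<noteq> (i, j)" "x \<in> X i j" "y \<in> X k l"
  shows "x \<otimes> y = y \<otimes> x"
  using commutator_trivial[OF assms] assms commutator_eq_one_iff by simp

text \<open>The root of \<open>t\<close> added to the root of \<open>x\<close> or of
  \<open>y\<close> is not a root, so \<open>t\<close> commutes with both arguments. Unlike full
  commutativity of \<open>X i k\<close>, this is available from the axioms directly.\<close>

lemma commutator_commute:
  assumes "i \<noteq> j" "j \<noteq> k" "i \<noteq> k" "x \<in> X i j" "y \<in> X j k" "t \<in> X i k"
  shows "t \<otimes> (x \<star> y) = (x \<star> y) \<otimes> t"
  using assms X_commute_distinct[of i k i j t x] X_commute_distinct[of i k j k t y]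
  by (intro commute_commutator) auto

text \<open>\<open>Weyl_triple\<close> is applied to \<open>X j k\<close> and \<open>X i k\<close>,
  and then to \<open>X k i\<close> and \<open>X k j\<close>. The clauses on \<open>h\<close> express
  surjectivity of the action; they keep a conjugate by \<open>a \<star> g\<close> because the root
  subgroups are not yet known to be abelian.\<close>

lemma Weyl_data:
  assumes "i \<noteq> j"
  obtains a b c where "a \<in> X i j" "b \<in> X j i" "c \<in> X i j"
    "\<forall>k g. k \<noteq> i \<and> k \<noteq> j \<and> (g \<in> X j k \<or> g \<in> X k i) \<longrightarrow> b \<star> (c \<star> g) = inv g"
    "\<forall>k h. k \<noteq> i \<and> k \<noteq> j \<and> h \<in> X i k \<longrightarrow>
       (\<exists>g\<in>X j k. h = inv (a \<star> g) \<otimes> ((c \<star> g) \<otimes> (a \<star> g)))"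
    "\<forall>k h. k \<noteq> i \<and> k \<noteq> j \<and> h \<in> X k j \<longrightarrow>
       (\<exists>g\<in>X k i. h = inv (a \<star> g) \<otimes> ((c \<star> g) \<otimes> (a \<star> g)))"
proof -
  obtain a b c where abc: "a \<in> X i j" "b \<in> X j i" "c \<in> X i j"
    and n: "\<And>k. k \<noteq> i \<Longrightarrow> k \<noteq> j \<Longrightarrow>
        (\<lambda>g. (a \<otimes> b \<otimes> c) \<otimes> g \<otimes> inv (a \<otimes> b \<otimes> c)) ` X j k = X i k"
      "\<And>k. k \<noteq> i \<Longrightarrow> k \<noteq> j \<Longrightarrow>
        (\<lambda>g. (a \<otimes> b \<otimes> c) \<otimes> g \<otimes> inv (a \<otimes> b \<otimes> c)) ` X k i = X k j"
    using Weyl_exists[OF assms] by metis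
  \<comment> \<open>\<open>commutator_X\<close> covers one order of the arguments only; the other
    order follows by inversion and is needed for the columns.\<close>
  have swap: "y \<star> x \<in> X r t" if "r \<noteq> s" "s \<noteq> t" "r \<noteq> t" "x \<in> X r s" "y \<in> X s t" for r s t x y
  proof -
    have "inv (x \<star> y) \<in> X r t" using commutator_X[OF that] that(3) by simp
    then show ?thesis using that by (simp add: inv_commutator)
  qed
  have row: "b \<star> (c \<star> g) = inv g \<and> (a \<otimes> b \<otimes> c) \<otimes> g \<otimes> inv (a \<otimes> b \<otimes> c)
      = inv (a \<star> g) \<otimes> ((c \<star> g) \<otimes> (a \<star> g))"
    if k: "k \<noteq> i" "k \<noteq> j" and g: "g \<in> X j k" for k g
  proof -
    have "\<And>x y. x \<in> X j k \<Longrightarrow> y \<in> X i k \<Longrightarrow> x \<otimes> y = y \<otimes> x"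
      by (rule X_commute_distinct[of j k i k]) (use assms k in auto)
    moreover have "\<And>x. x \<in> X j k \<Longrightarrow> b \<otimes> x = x \<otimes> b"
      by (rule X_commute_distinct[of j i j k]) (use assms k abc in auto)
    moreover have "\<And>y. y \<in> X i k \<Longrightarrow> a \<otimes> y = y \<otimes> a"
      by (rule X_commute_distinct[of i j i k]) (use assms k abc in auto)
    moreover have "\<And>u x. u \<in> X i j \<Longrightarrow> x \<in> X j k \<Longrightarrow> u \<star> x \<in> X i k"
      by (rule commutator_X[of i j k]) (use assms k in auto)
    moreover have "\<And>y. y \<in> X i k \<Longrightarrow> b \<star> y \<in> X j k"
      by (rule commutator_X[of j i k]) (use assms k abc in auto)
    moreover have "X j k \<inter> X i k \<subseteq> {\<one>}"
      by (rule Int_trivial_column[of j i k]) (use assms k in auto)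
    moreover have "subgroup (X j k) G" "subgroup (X i k) G" "a \<in> carrier G" "b \<in> carrier G"
      "c \<in> carrier G" "(a \<otimes> b \<otimes> c) \<otimes> g \<otimes> inv (a \<otimes> b \<otimes> c) \<in> X i k"
      using assms k abc g n(1)[OF k] by (auto intro: subgroup_X X_carrier)
    ultimately show ?thesis
      using abc g by (intro conjI Weyl_triple[where A = "X j k" and B = "X i k"]) blast+
  qed
  have col: "b \<star> (c \<star> g) = inv g \<and> (a \<otimes> b \<otimes> c) \<otimes> g \<otimes> inv (a \<otimes> b \<otimes> c)
      = inv (a \<star> g) \<otimes> ((c \<star> g) \<otimes> (a \<star> g))"
    if k: "k \<noteq> i" "k \<noteq> j" and g: "g \<in> X k i" for k g
  proof -
    have "\<And>x y. x \<in> X k i \<Longrightarrow> y \<in> X k j \<Longrightarrow> x \<otimes> y = y \<otimes> x"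
      by (rule X_commute_distinct[of k i k j]) (use assms k in auto)
    moreover have "\<And>x. x \<in> X k i \<Longrightarrow> b \<otimes> x = x \<otimes> b"
      by (rule X_commute_distinct[of j i k i]) (use assms k abc in auto)
    moreover have "\<And>y. y \<in> X k j \<Longrightarrow> a \<otimes> y = y \<otimes> a"
      by (rule X_commute_distinct[of i j k j]) (use assms k abc in auto)
    moreover have "\<And>u x. u \<in> X i j \<Longrightarrow> x \<in> X k i \<Longrightarrow> u \<star> x \<in> X k j"
      by (rule swap[of k i j]) (use assms k in auto)
    moreover have "\<And>y. y \<in> X k j \<Longrightarrow> b \<star> y \<in> X k i"
      by (rule swap[of k j i]) (use assms k abc in auto)
    moreover have "X k i \<inter> X k j \<subseteq> {\<one>}"
      by (rule Int_trivial_row[of k i j]) (use assms k in auto)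
    moreover have "subgroup (X k i) G" "subgroup (X k j) G" "a \<in> carrier G" "b \<in> carrier G"
      "c \<in> carrier G" "(a \<otimes> b \<otimes> c) \<otimes> g \<otimes> inv (a \<otimes> b \<otimes> c) \<in> X k j"
      using assms k abc g n(2)[OF k] by (auto intro: subgroup_X X_carrier)
    ultimately show ?thesis
      using abc g by (intro conjI Weyl_triple[where A = "X k i" and B = "X k j"]) blast+
  qed
  have rs: "\<exists>g\<in>X j k. h = inv (a \<star> g) \<otimes> ((c \<star> g) \<otimes> (a \<star> g))"
    if k: "k \<noteq> i" "k \<noteq> j" and h: "h \<in> X i k" for k h
  proof -
    obtain g where g: "g \<in> X j k" "h = (a \<otimes> b \<otimes> c) \<otimes> g \<otimes> inv (a \<otimes> b \<otimes> c)"
      using h unfolding n(1)[OF k, symmetric] by blast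
    then show ?thesis using row[OF k g(1)] by auto
  qed
  have ls: "\<exists>g\<in>X k i. h = inv (a \<star> g) \<otimes> ((c \<star> g) \<otimes> (a \<star> g))"
    if k: "k \<noteq> i" "k \<noteq> j" and h: "h \<in> X k j" for k h
  proof -
    obtain g where g: "g \<in> X k i" "h = (a \<otimes> b \<otimes> c) \<otimes> g \<otimes> inv (a \<otimes> b \<otimes> c)"
      using h unfolding n(2)[OF k, symmetric] by blast
    then show ?thesis using col[OF k g(1)] by auto
  qed
  show thesis
    by (rule that[OF abc]) (use row col rs ls in blast)+
qed

text \<open>Through a third index \<open>j\<close>, the element \<open>h\<close> is a product of
  commutators of \<open>X i j\<close> with \<open>X j k\<close> and their inverses, and
  \<open>t\<close> commutes with each of them.\<close>

lemma X_abelian: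
  assumes ik: "i \<noteq> k" and t: "t \<in> X i k" and h: "h \<in> X i k"
  shows "t \<otimes> h = h \<otimes> t"
proof -
  obtain j where j: "j \<noteq> i" "j \<noteq> k" "j \<noteq> k" by (rule fresh_index)
  from j(1) have ij: "i \<noteq> j" by simp
  obtain a b c where abc: "a \<in> X i j" "b \<in> X j i" "c \<in> X i j"
    and r: "\<forall>k g. k \<noteq> i \<and> k \<noteq> j \<and> (g \<in> X j k \<or> g \<in> X k i) \<longrightarrow> b \<star> (c \<star> g) = inv g"
    and *: "\<forall>k h. k \<noteq> i \<and> k \<noteq> j \<and> h \<in> X i k \<longrightarrow>
       (\<exists>g\<in>X j k. h = inv (a \<star> g) \<otimes> ((c \<star> g) \<otimes> (a \<star> g)))"
    and l: "\<forall>k h. k \<noteq> i \<and> k \<noteq> j \<and> h \<in> X k j \<longrightarrow>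
       (\<exists>g\<in>X k i. h = inv (a \<star> g) \<otimes> ((c \<star> g) \<otimes> (a \<star> g)))"
    by (rule Weyl_data[OF ij]) blast
  obtain g where g: "g \<in> X j k" "h = inv (a \<star> g) \<otimes> ((c \<star> g) \<otimes> (a \<star> g))"
    using * j ik h by metis
  have tx: "t \<otimes> (x \<star> g) = (x \<star> g) \<otimes> t" if "x \<in> X i j" for x
    using commutator_commute[of i j k x g t] that j ik g t by simp
  have "a \<star> g \<in> carrier G" "c \<star> g \<in> carrier G" "t \<in> carrier G"
    using X_carrier[OF abc(1) ij] X_carrier[OF abc(3) ij] X_carrier[OF g(1) j(2)] X_carrier[OF t ik]
    by auto
  then show ?thesis
    unfolding g(2) using tx[OF abc(1)] tx[OF abc(3)]
    by (intro commute_mult commute_inv) (simp_all only: inv_closed m_closed)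
qed

lemma X_commute:
  assumes "i \<noteq> j" "k \<noteq> l" "j \<noteq> k" "i \<noteq> l" "x \<in> X i j" "y \<in> X k l"
  shows "x \<otimes> y = y \<otimes> x"
  using assms X_abelian[of i j x y] X_commute_distinct[of i j k l x y]
  by (cases "(k, l) = (i, j)") auto

section \<open>Biadditivity and associativity of the commutator composition\<close>

lemma comm_prod_mult_left:
  assumes "i \<noteq> j" "j \<noteq> k" "i \<noteq> k" "x \<in> X i j" "x' \<in> X i j" "y \<in> X j k"
  shows "(x \<otimes> x') \<star> y = (x \<star> y) \<otimes> (x' \<star> y)"
proof -
  have m: "x \<star> y \<in> X i k" "x' \<star> y \<in> X i k" using assms commutator_X[OF assms(1-3)] by auto
  \<comment> \<open>The product formula for commutators contains a conjugation by \<open>x\<close>;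
    it disappears because \<open>X i j\<close> and \<open>X i k\<close> commute.\<close>
  have "x \<otimes> (x' \<star> y) = (x' \<star> y) \<otimes> x" by (rule X_commute[of i j i k]) (use assms m in auto)
  then show ?thesis
    using assms m X_abelian[OF assms(3) m(2) m(1)] conjugate_fixed[of x "x' \<star> y"]
    by (simp add: commutator_mult_left)
qed

lemma comm_prod_mult_right:
  assumes "i \<noteq> j" "j \<noteq> k" "i \<noteq> k" "x \<in> X i j" "y \<in> X j k" "y' \<in> X j k"
  shows "x \<star> (y \<otimes> y') = (x \<star> y) \<otimes> (x \<star> y')"
proof -
  have m: "x \<star> y \<in> X i k" "x \<star> y' \<in> X i k" using assms commutator_X[OF assms(1-3)] by auto
  have "y \<otimes> (x \<star> y') = (x \<star> y') \<otimes> y" by (rule X_commute[of j k i k]) (use assms m in auto)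
  then show ?thesis
    using assms m conjugate_fixed[of y "x \<star> y'"] by (simp add: commutator_mult_right)
qed

lemma comm_prod_inv_left:
  assumes "i \<noteq> j" "j \<noteq> k" "i \<noteq> k" "x \<in> X i j" "y \<in> X j k"
  shows "inv x \<star> y = inv (x \<star> y)"
  using assms comm_prod_mult_left[of i j k "inv x" x y] by (simp add: inv_equality)

lemma comm_prod_inv_right:
  assumes "i \<noteq> j" "j \<noteq> k" "i \<noteq> k" "x \<in> X i j" "y \<in> X j k"
  shows "x \<star> inv y = inv (x \<star> y)"
  using assms comm_prod_mult_right[of i j k x "inv y" y] by (simp add: inv_equality)

text \<open>Conjugation of \<open>y \<star> z\<close> by \<open>x\<close> is computed twice:
  directly, and inside the commutator, where \<open>x\<close> fixes \<open>z\<close> because the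
  four indices are distinct. The common factor \<open>y \<star> z\<close> then cancels.\<close>

lemma comm_prod_assoc:
  assumes d: "distinct [i, j, k, l]" and x: "x \<in> X i j" and y: "y \<in> X j k" and z: "z \<in> X k l"
  shows "(x \<star> y) \<star> z = x \<star> (y \<star> z)"
proof -
  have xy: "x \<star> y \<in> X i k" and yz: "y \<star> z \<in> X j l"
    using commutator_X[of i j k x y] commutator_X[of j k l y z] assms by auto
  have xyz: "(x \<star> y) \<star> z \<in> X i l" using xy z d commutator_X[of i k l] by simp
  have [simp]: "x \<in> carrier G" "y \<in> carrier G" "z \<in> carrier G" 
    using X_carrier[OF x] X_carrier[OF y] X_carrier[OF z] d by auto
  have "(x \<star> (y \<star> z)) \<otimes> (y \<star> z) = x \<otimes> (y \<star> z) \<otimes> inv x"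
    by (simp add: conjugate_eq_commutator)
  also have "\<dots> = (x \<otimes> y \<otimes> inv x) \<star> (x \<otimes> z \<otimes> inv x)"
    by (simp add: commutator_def inv_mult_group m_assoc)
  also have "x \<otimes> z \<otimes> inv x = z"
    using d X_commute[of i j k l x z] x z by (intro conjugate_fixed) auto
  also have "x \<otimes> y \<otimes> inv x = (x \<star> y) \<otimes> y" by (simp add: conjugate_eq_commutator)
  also have "((x \<star> y) \<otimes> y) \<star> z = ((x \<star> y) \<otimes> (y \<star> z) \<otimes> inv (x \<star> y)) \<otimes> ((x \<star> y) \<star> z)"
    by (simp add: commutator_mult_left)
  also have "(x \<star> y) \<otimes> (y \<star> z) \<otimes> inv (x \<star> y) = y \<star> z"
    using d X_commute[of i k j l "x \<star> y" "y \<star> z"] xy yz by (intro conjugate_fixed) auto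
  also have "(y \<star> z) \<otimes> ((x \<star> y) \<star> z) = ((x \<star> y) \<star> z) \<otimes> (y \<star> z)"
    using d X_commute[of j l i l "y \<star> z" "(x \<star> y) \<star> z"] yz xyz by auto
  finally show ?thesis by simp
qed

text \<open>The products of \<open>c\<close> and \<open>d\<close> would belong to diagonal
  positions, where no root subgroup exists. Invertibility is therefore expressed by the actions on
  rows and columns at a third index.\<close>

definition inverse_pair :: "'n \<Rightarrow> 'n \<Rightarrow> 'a \<Rightarrow> 'a \<Rightarrow> bool" where
  "inverse_pair i j c d \<longleftrightarrow> c \<in> X i j \<and> d \<in> X j i \<and> (\<forall>k. k \<noteq> i \<and> k \<noteq> j \<longrightarrow>
     (\<forall>g\<in>X j k. d \<star> (c \<star> g) = g) \<and> (\<forall>g\<in>X k i. (g \<star> c) \<star> d = g) \<and>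
     (\<forall>h\<in>X i k. c \<star> (d \<star> h) = h) \<and> (\<forall>h\<in>X k j. (h \<star> d) \<star> c = h))"

text \<open>For a Weyl element \<open>a \<otimes> b \<otimes> c\<close> the pair consists of
  \<open>c\<close> and \<open>inv b\<close>. One composition is the identity by the vanishing found
  in \<open>Weyl_triple\<close>; the other follows because commutation with \<open>c\<close> is
  onto.\<close>

lemma inverse_pair_exists:
  assumes ij: "i \<noteq> j"
  shows "\<exists>c d. inverse_pair i j c d"
proof -
  obtain a b c where abc: "a \<in> X i j" "b \<in> X j i" "c \<in> X i j"
    and r: "\<forall>k g. k \<noteq> i \<and> k \<noteq> j \<and> (g \<in> X j k \<or> g \<in> X k i) \<longrightarrow> b \<star> (c \<star> g) = inv g"
    and rs: "\<forall>k h. k \<noteq> i \<and> k \<noteq> j \<and> h \<in> X i k \<longrightarrow>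
       (\<exists>g\<in>X j k. h = inv (a \<star> g) \<otimes> ((c \<star> g) \<otimes> (a \<star> g)))"
    and ls: "\<forall>k h. k \<noteq> i \<and> k \<noteq> j \<and> h \<in> X k j \<longrightarrow>
       (\<exists>g\<in>X k i. h = inv (a \<star> g) \<otimes> ((c \<star> g) \<otimes> (a \<star> g)))"
    by (rule Weyl_data[OF ij]) blast
  have "inverse_pair i j c (inv b)"
    unfolding inverse_pair_def
  proof (intro conjI allI impI)
    show "c \<in> X i j" "inv b \<in> X j i" using abc ij by auto
  next
    fix k assume "k \<noteq> i \<and> k \<noteq> j"
    then have k: "k \<noteq> i" "k \<noteq> j" by auto
    have 1: "inv b \<star> (c \<star> g) = g" if "g \<in> X j k" for g
    proof -
      have "inv b \<star> (c \<star> g) = inv (b \<star> (c \<star> g))"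
        by (rule comm_prod_inv_left[of j i k]) (use ij k abc that in \<open>auto intro: commutator_X\<close>)
      then show ?thesis using r that k by (metis X_carrier inv_inv)
    qed
    have 2: "(g \<star> c) \<star> inv b = g" if "g \<in> X k i" for g
    proof -
      have gc: "g \<star> c \<in> X k j"
        by (rule commutator_X[of k i j]) (use ij k abc that in auto)
      have [simp]: "g \<in> carrier G" "b \<in> carrier G" "c \<in> carrier G" using abc ij that k by auto
      \<comment> \<open>Reversing both commutators turns the identity for
        \<open>b \<star> (c \<star> g)\<close> into one for commutation from the right; biadditivity
        moves the inverses.\<close>
      have "(g \<star> c) \<star> inv b = inv ((g \<star> c) \<star> b)"
        by (rule comm_prod_inv_right[of k j i]) (use ij k abc gc in auto)
      also have "\<dots> = inv (g \<star> c) \<star> b"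
        by (rule comm_prod_inv_left[symmetric, of k j i]) (use ij k abc gc in auto)
      also have "\<dots> = inv (b \<star> (c \<star> g))" by (simp add: inv_commutator)
      finally show ?thesis using r that k by (metis X_carrier inv_inv)
    qed
    show "\<forall>g\<in>X j k. inv b \<star> (c \<star> g) = g" "\<forall>g\<in>X k i. (g \<star> c) \<star> inv b = g"
      using 1 2 by auto
    show "\<forall>h\<in>X i k. c \<star> (inv b \<star> h) = h"
    proof
      fix h assume "h \<in> X i k"
      then obtain g where g: "g \<in> X j k" "h = inv (a \<star> g) \<otimes> ((c \<star> g) \<otimes> (a \<star> g))"
        using rs k by blast
      have m: "a \<star> g \<in> X i k" "c \<star> g \<in> X i k"
        using ij k abc g by (auto intro: commutator_X)
      \<comment> \<open>Commutativity of the root subgroup removes the conjugation by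
        \<open>a \<star> g\<close>.\<close>
      have "h = c \<star> g"
        using k m X_abelian[of i k "c \<star> g" "a \<star> g"] unfolding g(2) by simp
      then show "c \<star> (inv b \<star> h) = h" using 1[OF g(1)] by simp
    qed
    show "\<forall>h\<in>X k j. (h \<star> inv b) \<star> c = h"
    proof
      fix h assume "h \<in> X k j"
      then obtain g where g: "g \<in> X k i" "h = inv (a \<star> g) \<otimes> ((c \<star> g) \<otimes> (a \<star> g))"
        using ls k by blast
      have [simp]: "g \<in> carrier G" "a \<in> carrier G" "c \<in> carrier G" using abc ij g k by auto
      have "g \<star> a \<in> X k j" "g \<star> c \<in> X k j"
        using ij k abc g by (auto intro: commutator_X)
      then have m: "a \<star> g \<in> X k j" "c \<star> g \<in> X k j"
        using X_inv[of _ k j] k by (auto simp flip: inv_commutator[of g])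
      have "h = c \<star> g"
        using k m X_abelian[of k j "c \<star> g" "a \<star> g"] unfolding g(2) by simp
      \<comment> \<open>Swapping the arguments inverts the commutator, so the preimage of
        \<open>h\<close> under commutation from the right is \<open>inv g\<close> and not
        \<open>g\<close>.\<close>
      then have "h = inv g \<star> c"
        using comm_prod_inv_left[of k i j g c] k ij g abc by (simp add: inv_commutator)
      then show "(h \<star> inv b) \<star> c = h" using 2[of "inv g"] g(1) k by simp
    qed
  qed
  then show ?thesis by blast
qed

end


section \<open>Coordinates\<close>

context A_graded
begin

definition third :: "'n \<Rightarrow> 'n \<Rightarrow> 'n" where
  "third i j = (SOME m. m \<noteq> i \<and> m \<noteq> j)"

lemma third: "third i j \<noteq> i" "third i j \<noteq> j" "i \<noteq> third i j" "j \<noteq> third i j"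
proof -
  obtain m where "m \<noteq> i" "m \<noteq> j" "m \<noteq> j" by (rule fresh_index)
  then have "third i j \<noteq> i \<and> third i j \<noteq> j" unfolding third_def by (intro someI) auto
  then show "third i j \<noteq> i" "third i j \<noteq> j" "i \<noteq> third i j" "j \<noteq> third i j" by auto
qed

end

text \<open>
  The elements \<open>e i j\<close> play the role of the matrix units: they compose like them as far as the
  commutators are defined, and \<open>e i r\<close> and \<open>e r i\<close> are mutually inverse for the base index \<open>r\<close>.
\<close>

locale A_graded_units = A_graded G X
    for G :: "('a, 'z) monoid_scheme" (structure) and X :: "'n::finite \<Rightarrow> 'n \<Rightarrow> 'a set" +
  fixes e :: "'n \<Rightarrow> 'n \<Rightarrow> 'a" and r :: 'n
  assumes e_comp: "distinct [i, j, k] \<Longrightarrow> e i j \<star> e j k = e i k"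
    and e_inverse: "i \<noteq> r \<Longrightarrow> inverse_pair r i (e r i) (e i r)"
    and e_mem: "i \<noteq> j \<Longrightarrow> e i j \<in> X i j"

text \<open>Every index is joined to \<open>r\<close> by an inverse pair \<open>p i\<close>,
  \<open>q i\<close>, and \<open>e i j\<close> is the path from \<open>i\<close> to \<open>j\<close>
  through \<open>r\<close>. In a product of two such paths the middle factors \<open>p j\<close> and
  \<open>q j\<close> cancel.\<close>

lemma (in A_graded) A_graded_units_exists: "\<exists>e. A_graded_units G X e r"
proof -
  have "\<exists>c d. inverse_pair r i c d" if "i \<noteq> r" for i
    using that inverse_pair_exists[of r i] by auto
  then obtain p q where pq: "\<And>i. i \<noteq> r \<Longrightarrow> inverse_pair r i (p i) (q i)"
    by metis
  have p: "p i \<in> X r i" and q: "q i \<in> X i r" if "i \<noteq> r" for i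
    using pq[OF that] by (auto simp: inverse_pair_def)
  define e where "e i j = (if i = r then p j else if j = r then q i else q i \<star> p j)" for i j
  have pqp: "p j \<star> (q j \<star> p k) = p k" if "j \<noteq> r" "k \<noteq> r" "j \<noteq> k" for j k
    using pq[of j] p[of k] that unfolding inverse_pair_def by auto
  have qpq: "(q i \<star> p j) \<star> q j = q i" if "i \<noteq> r" "j \<noteq> r" "i \<noteq> j" for i j
    using pq[of j] q[of i] that unfolding inverse_pair_def by auto
  have mem: "e i j \<in> X i j" if "i \<noteq> j" for i j
    using that p[of j] q[of i] commutator_X[of i r j "q i" "p j"] by (auto simp: e_def)
  have comp: "e i j \<star> e j k = e i k" if d: "distinct [i, j, k]" for i j k
  proof -
    consider "i = r" | "j = r" | "k = r" | "i \<noteq> r" "j \<noteq> r" "k \<noteq> r" by blast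
    then show ?thesis
    proof cases
      case 4
      have "(q i \<star> p j) \<star> (q j \<star> p k) = ((q i \<star> p j) \<star> q j) \<star> p k"
        using 4 d p[of j] p[of k] q[of i] q[of j] commutator_X[of i r j "q i" "p j"]
        by (intro comm_prod_assoc[symmetric, of i j r k]) auto
      then show ?thesis using 4 d qpq by (simp add: e_def)
    qed (use d pqp qpq in \<open>auto simp: e_def\<close>)
  qed
  have "A_graded_units_axioms G X e r"
    by (rule A_graded_units_axioms.intro) (use mem comp pq in \<open>simp_all add: e_def\<close>)
  then show ?thesis using A_graded_units.intro[OF A_graded_axioms] by blast
qed

section \<open>Cancellation of the units and coherent families\<close>

context A_graded_units
begin

lemma prod_mem: "distinct [i, j, k] \<Longrightarrow> x \<in> X i j \<Longrightarrow> y \<in> X j k \<Longrightarrow> x \<star> y \<in> X i k"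
  using commutator_X by auto

lemma e_inverse_rules:
  assumes "i \<noteq> r" "k \<noteq> r" "k \<noteq> i"
  shows "g \<in> X i k \<Longrightarrow> e i r \<star> (e r i \<star> g) = g" and "g \<in> X k r \<Longrightarrow> (g \<star> e r i) \<star> e i r = g"
    and "g \<in> X r k \<Longrightarrow> e r i \<star> (e i r \<star> g) = g" and "g \<in> X k i \<Longrightarrow> (g \<star> e i r) \<star> e r i = g"
  using e_inverse[OF assms(1)] assms(2,3) unfolding inverse_pair_def by blast+

text \<open>If \<open>j\<close> or \<open>k\<close> is the base index, this is a defining property
  of the units. Otherwise \<open>e j k\<close> factors through \<open>r\<close>, and associativity
  for \<open>i\<close>, \<open>j\<close>, \<open>r\<close>, \<open>k\<close> applies as long as
  \<open>i\<close> differs from \<open>r\<close>.\<close>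

lemma e_right_inverse:
  assumes d: "distinct [i, j, k]" and g: "g \<in> X i j"
  shows "(g \<star> e j k) \<star> e k j = g"
proof -
  have *: "(g \<star> e j k) \<star> e k j = g"
    if d: "distinct [i, j, k]" and i: "i \<noteq> r" and g: "g \<in> X i j" for i j k g
  proof -
    consider "j = r" | "k = r" | "j \<noteq> r" "k \<noteq> r" by blast
    then show ?thesis
    proof cases
      case 3
      have "g \<star> e j k = g \<star> (e j r \<star> e r k)" using e_comp[of j r k] 3 d by auto
      also have "\<dots> = (g \<star> e j r) \<star> e r k"
        using 3 d i g by (intro comm_prod_assoc[symmetric, of i j r k] e_mem) auto
      finally have "(g \<star> e j k) \<star> e k j = ((g \<star> e j r) \<star> e r k) \<star> e k j" by simp
      also have "\<dots> = (g \<star> e j r) \<star> (e r k \<star> e k j)"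
        using 3 d i g by (intro comm_prod_assoc[of i r k j] e_mem prod_mem[of i j r]) auto
      also have "\<dots> = (g \<star> e j r) \<star> e r j" using e_comp[of r k j] 3 d by auto
      also have "\<dots> = g" using e_inverse_rules(4)[of j i g] 3 d i g by simp
      finally show ?thesis .
    qed (use d i g e_inverse_rules(2)[of k i g] e_inverse_rules(4)[of j i g] in auto)
  qed
  show ?thesis
  proof (cases "i = r")
    case True
    \<comment> \<open>In row \<open>r\<close> there is no room for a detour through
      \<open>r\<close>; the element is first moved to another row \<open>l\<close> and moved back
      afterwards.\<close>
    obtain l where l: "l \<noteq> r" "l \<noteq> j" "l \<noteq> k" by (rule fresh_index)
    define h where "h = e l r \<star> g"
    have h: "h \<in> X l j" unfolding h_def
      using l d g True by (intro prod_mem[of l r j] e_mem) auto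
    have gh: "g = e r l \<star> h"
      unfolding h_def using e_inverse_rules(3)[of l j g] l d g True by auto
    have "(g \<star> e j k) \<star> e k j = (e r l \<star> (h \<star> e j k)) \<star> e k j"
      unfolding gh using l d h True by (subst comm_prod_assoc[of r l j k]) (auto intro: e_mem)
    also have "\<dots> = e r l \<star> ((h \<star> e j k) \<star> e k j)"
      using l d h True by (intro comm_prod_assoc[of r l k j] e_mem prod_mem[of l j k]) auto
    also have "(h \<star> e j k) \<star> e k j = h" using l d h by (intro *) auto
    finally show ?thesis using gh by simp
  qed (use * d g in blast)
qed

text \<open>The diagonal entries are a normalisation: with them fixed, equality of families is
  equality of functions.\<close>

definition coherent :: "('n \<Rightarrow> 'n \<Rightarrow> 'a) \<Rightarrow> bool" where
  "coherent x \<longleftrightarrow> (\<forall>i. x i i = \<one>) \<and> (\<forall>i j. i \<noteq> j \<longrightarrow> x i j \<in> X i j) \<and>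
     (\<forall>i j k. distinct [i, j, k] \<longrightarrow> x i j \<star> e j k = x i k \<and> e i j \<star> x j k = x i k)"

lemma coherentD:
  assumes "coherent x"
  shows "x i i = \<one>" and "i \<noteq> j \<Longrightarrow> x i j \<in> X i j"
    and "distinct [i, j, k] \<Longrightarrow> x i j \<star> e j k = x i k"
    and "distinct [i, j, k] \<Longrightarrow> e i j \<star> x j k = x i k"
  using assms unfolding coherent_def by blast+

text \<open>Right commutation with units carries the known entry along row \<open>i\<close>, left
  commutation spreads this row to all columns except \<open>i\<close>, and column \<open>i\<close>
  is reached last, from a neighbouring column.\<close>

lemma coherent_eqI:
  assumes x: "coherent x" and y: "coherent y" and ij: "i \<noteq> j" and eq: "x i j = y i j"
  shows "x = y"
proof -
  have 1: "x i k = y i k" if "k \<noteq> i" for k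
    using coherentD(3)[OF x, of i j k] coherentD(3)[OF y, of i j k] eq ij that
    by (cases "k = j") auto
  have 2: "x k l = y k l" if "k \<noteq> l" "l \<noteq> i" for k l
    using coherentD(4)[OF x, of k i l] coherentD(4)[OF y, of k i l] 1[of l] that
    by (cases "k = i") auto
  have 3: "x k i = y k i" if "k \<noteq> i" for k
    using coherentD(3)[OF x, of k "third k i" i] coherentD(3)[OF y, of k "third k i" i]
      2[of k "third k i"] that third[of k i] by auto
  have "x k l = y k l" for k l
    using 1[of l] 2[of k l] 3[of k] coherentD(1)[OF x] coherentD(1)[OF y]
    by (cases "k = l"; cases "l = i") auto
  then show ?thesis by blast
qed

text \<open>The family is built outwards from row \<open>r\<close>: \<open>row\<close> carries
  \<open>g\<close> along this row, \<open>A\<close> fills the positions avoiding \<open>r\<close>,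
  and column \<open>r\<close> is reached from \<open>A\<close> through a third index.\<close>

lemma coherent_extend_base:
  assumes t: "t \<noteq> r" and g: "g \<in> X r t"
  shows "\<exists>x. coherent x \<and> x r t = g"
proof -
  define row where "row k = (if k = t then g else g \<star> e t k)" for k
  have row_mem: "row k \<in> X r k" if "k \<noteq> r" for k
    using t g that by (auto simp: row_def intro!: prod_mem[of r t k] e_mem)
  have row_e: "row k \<star> e k l = row l" if "k \<noteq> r" "l \<noteq> r" "k \<noteq> l" for k l
  proof -
    consider "k = t" | "l = t" | "k \<noteq> t" "l \<noteq> t" by blast
    then show ?thesis
    proof cases
      case 2
      \<comment> \<open>The step from \<open>t\<close> to \<open>k\<close> is retraced here, which
        is cancellation rather than composition of units.\<close>
      then show ?thesis using e_right_inverse[of r t k g] that t g by (auto simp: row_def)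
    next
      case 3
      have "(g \<star> e t k) \<star> e k l = g \<star> (e t k \<star> e k l)"
        using 3 that t g by (intro comm_prod_assoc[of r t k l] e_mem) auto
      then show ?thesis using 3 that e_comp[of t k l] by (simp add: row_def)
    qed (use that in \<open>auto simp: row_def\<close>)
  qed
  define A where "A i j = e i r \<star> row j" for i j
  have A_mem: "A i j \<in> X i j" if "distinct [i, j, r]" for i j
    unfolding A_def using that row_mem by (intro prod_mem[of i r j] e_mem) auto
  have A_right: "A i j \<star> e j k = A i k" if "distinct [i, j, k, r]" for i j k
  proof -
    have "A i j \<star> e j k = e i r \<star> (row j \<star> e j k)"
      unfolding A_def using that row_mem by (intro comm_prod_assoc[of i r j k] e_mem) auto
    then show ?thesis using row_e[of j k] that by (simp add: A_def)
  qed
  have A_left: "e i j \<star> A j k = A i k" if "distinct [i, j, k, r]" for i j k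
  proof -
    have "e i j \<star> A j k = (e i j \<star> e j r) \<star> row k"
      unfolding A_def using that row_mem
      by (intro comm_prod_assoc[symmetric, of i j r k] e_mem) auto
    then show ?thesis using e_comp[of i j r] that by (simp add: A_def)
  qed
  define x where "x i j = (if i = j then \<one> else if i = r then row j
      else if j \<noteq> r then A i j else A i (third i r) \<star> e (third i r) r)" for i j
  \<comment> \<open>The intermediate index chosen by \<open>third\<close> is immaterial, so that
    each coherence condition below can use the one that suits it.\<close>
  have x_r: "x i r = A i m \<star> e m r" if "distinct [i, m, r]" for i m
  proof (cases "m = third i r")
    case True
    then show ?thesis using that by (auto simp: x_def)
  next
    case False
    have "A i m \<star> e m r = (A i (third i r) \<star> e (third i r) m) \<star> e m r"
      using A_right[of i "third i r" m] False that third[of i r] by auto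
    also have "\<dots> = A i (third i r) \<star> (e (third i r) m \<star> e m r)"
      using A_mem[of i "third i r"] False that third[of i r]
      by (intro comm_prod_assoc[of i "third i r" m r] e_mem) auto
    also have "e (third i r) m \<star> e m r = e (third i r) r"
      using False that third[of i r] by (intro e_comp) auto
    finally show ?thesis using that by (auto simp: x_def)
  qed
  have x_row: "x r j = row j" if "j \<noteq> r" for j using that by (auto simp: x_def)
  have x_A: "x i j = A i j" if "distinct [i, j, r]" for i j using that by (auto simp: x_def)
  have "coherent x"
    unfolding coherent_def
  proof (intro conjI allI impI)
    show "x i i = \<one>" for i by (simp add: x_def)
  next
    fix i j :: 'n assume ij: "i \<noteq> j"
    consider "i = r" | "j = r" | "distinct [i, j, r]" using ij by auto
    then show "x i j \<in> X i j"
    proof cases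
      case 2
      then show ?thesis
        using ij third[of i r] A_mem[of i "third i r"] unfolding x_def
        by (auto intro!: prod_mem[of i "third i r" r] e_mem)
    qed (use ij row_mem A_mem x_row x_A in auto)
  next
    fix i j k :: 'n assume d: "distinct [i, j, k]"
    consider "i = r" | "j = r" | "k = r" | "distinct [i, j, k, r]" using d by auto
    then show "x i j \<star> e j k = x i k"
    proof cases
      case 1
      then show ?thesis using d row_e x_row by auto
    next
      case 2
      then have "x i j \<star> e j k = (A i k \<star> e k r) \<star> e r k" using x_r[of i k] d by auto
      also have "\<dots> = A i k" using 2 d A_mem[of i k] e_inverse_rules(4)[of k i] by auto
      finally show ?thesis using 2 d x_A by auto
    next
      case 3
      then show ?thesis using d x_r[of i j] x_A by auto
    next
      case 4
      then show ?thesis using x_A A_right by auto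
    qed
  next
    fix i j k :: 'n assume d: "distinct [i, j, k]"
    consider "i = r" | "j = r" | "k = r" | "distinct [i, j, k, r]" using d by auto
    then show "e i j \<star> x j k = x i k"
    proof cases
      case 1
      then show ?thesis
        using d x_row x_A row_mem e_inverse_rules(3)[of j k] by (auto simp: A_def)
    next
      case 2
      then show ?thesis using d x_row x_A by (auto simp: A_def)
    next
      case 3
      \<comment> \<open>Column \<open>r\<close> is entered through an index different from
        \<open>i\<close>, \<open>j\<close> and \<open>r\<close>, so that associativity for
        \<open>i\<close>, \<open>j\<close>, \<open>m\<close>, \<open>r\<close> applies.\<close>
      obtain m where m: "m \<noteq> i" "m \<noteq> j" "m \<noteq> r" by (rule fresh_index)
      have "e i j \<star> x j k = e i j \<star> (A j m \<star> e m r)" using 3 d m x_r[of j m] by auto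
      also have "\<dots> = (e i j \<star> A j m) \<star> e m r"
        using 3 d m A_mem[of j m]
        by (intro comm_prod_assoc[symmetric, of i j m r] e_mem) auto
      also have "\<dots> = A i m \<star> e m r" using 3 d m A_left[of i j m] by auto
      also have "\<dots> = x i k" using 3 d m x_r[of i m] by auto
      finally show ?thesis .
    next
      case 4
      then show ?thesis using x_A A_left by auto
    qed
  qed
  moreover have "x r t = g" using t x_row by (simp add: row_def)
  ultimately show ?thesis by blast
qed

text \<open>Left commutation with \<open>e r i\<close> moves the entry to row \<open>r\<close>, and
  \<open>e i r\<close> undoes this. An entry in column \<open>r\<close> would land on the diagonal
  and is shifted to another column first.\<close>

lemma coherent_extend:
  assumes ij: "i \<noteq> j" and g: "g \<in> X i j"
  shows "\<exists>x. coherent x \<and> x i j = g"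
proof -
  have off: "\<exists>x. coherent x \<and> x i j = g" if d: "distinct [i, j, r]" and g: "g \<in> X i j" for i j g
  proof -
    have "e r i \<star> g \<in> X r j" using d g by (intro prod_mem[of r i j] e_mem) auto
    then obtain x where x: "coherent x" "x r j = e r i \<star> g"
      using coherent_extend_base[of j "e r i \<star> g"] d by auto
    have "x i j = e i r \<star> (e r i \<star> g)" using coherentD(4)[OF x(1), of i r j] x(2) d g by auto
    also have "\<dots> = g" using e_inverse_rules(1)[of i j g] d g by auto
    finally show ?thesis using x by blast
  qed
  consider "i = r" | "j = r" | "distinct [i, j, r]" using ij by auto
  then show ?thesis
  proof cases
    case 2
    define m where "m = third i r"
    have m: "m \<noteq> i" "m \<noteq> r" using third[of i r] by (auto simp: m_def)
    have "g \<star> e r m \<in> X i m" using ij 2 m g by (intro prod_mem[of i r m] e_mem) auto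
    then obtain x where x: "coherent x" "x i m = g \<star> e r m"
      using off[of i m] ij 2 m by auto
    have "x i j = (g \<star> e r m) \<star> e m r"
      using coherentD(3)[OF x(1), of i m r] x(2) ij 2 m by auto
    also have "\<dots> = g" using e_inverse_rules(2)[of m i g] ij 2 m g by auto
    finally show ?thesis using x by blast
  qed (use coherent_extend_base[of j g] off ij g in auto)
qed

text \<open>
  A coherent family behaves like the family of matrices with one fixed ring element \<open>x\<close> at the
  off-diagonal positions \<open>(i, j)\<close>.
\<close>

definition fam_mult :: "('n \<Rightarrow> 'n \<Rightarrow> 'a) \<Rightarrow> ('n \<Rightarrow> 'n \<Rightarrow> 'a) \<Rightarrow> 'n \<Rightarrow> 'n \<Rightarrow> 'a" where
  "fam_mult x y i k = (if i = k then \<one> else x i (third i k) \<star> y (third i k) k)"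

section \<open>The ring of coherent families\<close>

definition coord_ring :: "('n \<Rightarrow> 'n \<Rightarrow> 'a) ring" where
  "coord_ring =
     \<lparr>carrier = {x. coherent x}, mult = fam_mult, one = (\<lambda>i j. if i = j then \<one> else e i j),
      zero = (\<lambda>i j. \<one>), add = (\<lambda>x y i j. x i j \<otimes> y i j)\<rparr>"

text \<open>The middle index is immaterial: \<open>e m j\<close> is split off from the second factor
  by coherence and absorbed by the first.\<close>

lemma fam_mult_eq:
  assumes x: "coherent x" and y: "coherent y" and d: "distinct [i, j, k]"
  shows "fam_mult x y i k = x i j \<star> y j k"
proof (cases "j = third i k")
  case False
  define m where "m = third i k"
  have m: "m \<noteq> i" "m \<noteq> k" "m \<noteq> j" using third[of i k] False by (auto simp: m_def)
  have "x i m \<star> y m k = x i m \<star> (e m j \<star> y j k)"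
    using coherentD(4)[OF y, of m j k] m d by auto
  also have "\<dots> = (x i m \<star> e m j) \<star> y j k"
    using m d by (intro comm_prod_assoc[symmetric, of i m j k] e_mem coherentD x y) auto
  also have "\<dots> = x i j \<star> y j k"
    using coherentD(3)[OF x, of i m j] m d by auto
  finally show ?thesis using d by (simp add: fam_mult_def m_def)
qed (use d in \<open>auto simp: fam_mult_def\<close>)

lemma coherent_one: "coherent (\<lambda>i j. if i = j then \<one> else e i j)"
  using e_comp e_mem by (auto simp: coherent_def)

lemma coherent_zero: "coherent (\<lambda>i j. \<one>)"
  using e_mem X_carrier by (fastforce simp: coherent_def)

lemma coherent_add:
  assumes x: "coherent x" and y: "coherent y"
  shows "coherent (\<lambda>i j. x i j \<otimes> y i j)"
  unfolding coherent_def
proof (intro conjI allI impI)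
  fix i j k :: 'n assume d: "distinct [i, j, k]"
  note m = coherentD(2)[OF x] coherentD(2)[OF y] e_mem
  show "(x i j \<otimes> y i j) \<star> e j k = x i k \<otimes> y i k"
    using comm_prod_mult_left[of i j k "x i j" "y i j" "e j k"] m d
      coherentD(3)[OF x d] coherentD(3)[OF y d] by auto
  show "e i j \<star> (x j k \<otimes> y j k) = x i k \<otimes> y i k"
    using comm_prod_mult_right[of i j k "e i j" "x j k" "y j k"] m d
      coherentD(4)[OF x d] coherentD(4)[OF y d] by auto
qed (use coherentD[OF x] coherentD[OF y] in auto)

lemma coherent_minus:
  assumes x: "coherent x"
  shows "coherent (\<lambda>i j. inv (x i j))"
  unfolding coherent_def
proof (intro conjI allI impI)
  fix i j k :: 'n assume d: "distinct [i, j, k]"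
  note m = coherentD(2)[OF x] e_mem
  show "inv (x i j) \<star> e j k = inv (x i k)"
    using comm_prod_inv_left[of i j k "x i j" "e j k"] m d coherentD(3)[OF x d] by auto
  show "e i j \<star> inv (x j k) = inv (x i k)"
    using comm_prod_inv_right[of i j k "e i j" "x j k"] m d coherentD(4)[OF x d] by auto
qed (use coherentD[OF x] in auto)

lemma coherent_mult:
  assumes x: "coherent x" and y: "coherent y"
  shows "coherent (fam_mult x y)"
  unfolding coherent_def
proof (intro conjI allI impI)
  show "fam_mult x y i i = \<one>" for i by (simp add: fam_mult_def)
next
  fix i j :: 'n assume "i \<noteq> j"
  then show "fam_mult x y i j \<in> X i j"
    using third[of i j] unfolding fam_mult_def
    by (auto intro!: prod_mem[of i "third i j" j] coherentD(2)[OF x] coherentD(2)[OF y])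
next
  fix i j k :: 'n assume d: "distinct [i, j, k]"
  \<comment> \<open>A middle index away from \<open>i\<close>, \<open>j\<close>, \<open>k\<close>
    makes both sides products over four distinct indices.\<close>
  obtain m where m: "m \<noteq> i" "m \<noteq> j" "m \<noteq> k" by (rule fresh_index)
  have "fam_mult x y i j \<star> e j k = (x i m \<star> y m j) \<star> e j k"
    using fam_mult_eq[OF x y, of i m j] m d by auto
  also have "\<dots> = x i m \<star> (y m j \<star> e j k)"
    using m d by (intro comm_prod_assoc[of i m j k] e_mem coherentD x y) auto
  also have "\<dots> = fam_mult x y i k"
    using fam_mult_eq[OF x y, of i m k] coherentD(3)[OF y, of m j k] m d by auto
  finally show "fam_mult x y i j \<star> e j k = fam_mult x y i k" .
  have "e i j \<star> fam_mult x y j k = e i j \<star> (x j m \<star> y m k)"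
    using fam_mult_eq[OF x y, of j m k] m d by auto
  also have "\<dots> = (e i j \<star> x j m) \<star> y m k"
    using m d by (intro comm_prod_assoc[symmetric, of i j m k] e_mem coherentD x y) auto
  also have "\<dots> = fam_mult x y i k"
    using fam_mult_eq[OF x y, of i m k] coherentD(4)[OF x, of i j m] m d by auto
  finally show "e i j \<star> fam_mult x y j k = fam_mult x y i k" .
qed

lemma fam_mult_assoc:
  assumes x: "coherent x" and y: "coherent y" and z: "coherent z"
  shows "fam_mult (fam_mult x y) z = fam_mult x (fam_mult y z)"
proof (intro ext)
  fix i l
  show "fam_mult (fam_mult x y) z i l = fam_mult x (fam_mult y z) i l"
  proof (cases "i = l")
    case False
    obtain k where k: "k \<noteq> i" "k \<noteq> l" "k \<noteq> l" by (rule fresh_index)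
    obtain j where j: "j \<noteq> i" "j \<noteq> k" "j \<noteq> l" by (rule fresh_index)
    have "fam_mult (fam_mult x y) z i l = (x i j \<star> y j k) \<star> z k l"
      using fam_mult_eq[OF coherent_mult[OF x y] z, of i k l] fam_mult_eq[OF x y, of i j k]
        j k False by auto
    also have "\<dots> = x i j \<star> (y j k \<star> z k l)"
      using j k False by (intro comm_prod_assoc[of i j k l] coherentD x y z) auto
    also have "\<dots> = fam_mult x (fam_mult y z) i l"
      using fam_mult_eq[OF x coherent_mult[OF y z], of i j l] fam_mult_eq[OF y z, of j k l]
        j k False by auto
    finally show ?thesis .
  qed (simp add: fam_mult_def)
qed

lemma coherent_carrier: "coherent x \<Longrightarrow> x i j \<in> carrier G"
  by (metis X_carrier coherentD(1,2) one_closed)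

text \<open>The unit laws are the coherence conditions, distributivity is biadditivity of the
  composition, and addition commutes because root subgroups are abelian.\<close>

lemma ring_coord_ring: "ring coord_ring"
proof (rule ringI)
  show "abelian_group coord_ring"
  proof (rule abelian_groupI)
    fix x assume "x \<in> carrier coord_ring"
    then show "\<exists>y\<in>carrier coord_ring. y \<oplus>\<^bsub>coord_ring\<^esub> x = \<zero>\<^bsub>coord_ring\<^esub>"
      using coherent_minus[of x] coherent_carrier[of x]
      by (intro bexI[of _ "\<lambda>i j. inv (x i j)"]) (auto simp: coord_ring_def)
  next
    fix x y assume "x \<in> carrier coord_ring" "y \<in> carrier coord_ring"
    then have xy: "coherent x" "coherent y" by (auto simp: coord_ring_def)
    have "x i j \<otimes> y i j = y i j \<otimes> x i j" for i j
      using X_abelian[of i j "x i j" "y i j"] coherentD(1,2)[OF xy(1)] coherentD(1,2)[OF xy(2)]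
      by (cases "i = j") auto
    then show "x \<oplus>\<^bsub>coord_ring\<^esub> y = y \<oplus>\<^bsub>coord_ring\<^esub> x" by (simp add: coord_ring_def)
  qed (auto simp: coord_ring_def coherent_zero coherent_add coherent_carrier m_assoc)
next
  show "monoid coord_ring"
  proof (rule monoidI)
    fix x assume "x \<in> carrier coord_ring"
    then have x: "coherent x" by (simp add: coord_ring_def)
    have "fam_mult (\<lambda>i j. if i = j then \<one> else e i j) x i k = x i k" for i k
      using coherentD(1)[OF x] coherentD(4)[OF x, of i "third i k" k] third[of i k]
      by (auto simp: fam_mult_def)
    then show "\<one>\<^bsub>coord_ring\<^esub> \<otimes>\<^bsub>coord_ring\<^esub> x = x" by (auto simp: coord_ring_def)
    have "fam_mult x (\<lambda>i j. if i = j then \<one> else e i j) i k = x i k" for i k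
      using coherentD(1)[OF x] coherentD(3)[OF x, of i "third i k" k] third[of i k]
      by (auto simp: fam_mult_def)
    then show "x \<otimes>\<^bsub>coord_ring\<^esub> \<one>\<^bsub>coord_ring\<^esub> = x" by (auto simp: coord_ring_def)
  qed (auto simp: coord_ring_def coherent_one coherent_mult fam_mult_assoc)
next
  fix x y z assume "x \<in> carrier coord_ring" "y \<in> carrier coord_ring" "z \<in> carrier coord_ring"
  then have c: "coherent x" "coherent y" "coherent z" by (auto simp: coord_ring_def)
  have "fam_mult (\<lambda>i j. x i j \<otimes> y i j) z i k = fam_mult x z i k \<otimes> fam_mult y z i k" for i k
    using comm_prod_mult_left[of i "third i k" k] third[of i k] coherentD(2)[OF c(1)]
      coherentD(2)[OF c(2)] coherentD(2)[OF c(3)] by (auto simp: fam_mult_def)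
  then show "(x \<oplus>\<^bsub>coord_ring\<^esub> y) \<otimes>\<^bsub>coord_ring\<^esub> z
      = x \<otimes>\<^bsub>coord_ring\<^esub> z \<oplus>\<^bsub>coord_ring\<^esub> y \<otimes>\<^bsub>coord_ring\<^esub> z"
    by (auto simp: coord_ring_def)
  have "fam_mult z (\<lambda>i j. x i j \<otimes> y i j) i k = fam_mult z x i k \<otimes> fam_mult z y i k" for i k
    using comm_prod_mult_right[of i "third i k" k] third[of i k] coherentD(2)[OF c(1)]
      coherentD(2)[OF c(2)] coherentD(2)[OF c(3)] by (auto simp: fam_mult_def)
  then show "z \<otimes>\<^bsub>coord_ring\<^esub> (x \<oplus>\<^bsub>coord_ring\<^esub> y)
      = z \<otimes>\<^bsub>coord_ring\<^esub> x \<oplus>\<^bsub>coord_ring\<^esub> z \<otimes>\<^bsub>coord_ring\<^esub> y"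
    by (auto simp: coord_ring_def)
qed

lemma coord_ring_bij: "i \<noteq> j \<Longrightarrow> bij_betw (\<lambda>x. x i j) (carrier coord_ring) (X i j)"
  using coherent_extend[of i j] coherentD(2)[of _ i j] coherent_eqI[of _ _ i j]
  unfolding bij_betw_def inj_on_def coord_ring_def by force

end


text \<open>Evaluation at one off-diagonal position is injective on coherent families. Transport
  along it replaces families by single group elements, so that the ring lives on the type of the
  group. The base index is arbitrary.\<close>

lemma (in A_graded) coordinatization:
  "\<exists>(R :: 'a ring) \<phi>. ring R \<and> steinberg_family R G \<phi> \<and>
     (\<forall>i j. i \<noteq> j \<longrightarrow> bij_betw (\<phi> i j) (carrier R) (X i j))"
proof -
  obtain e where "A_graded_units G X e undefined" using A_graded_units_exists by blast
  then interpret A_graded_units G X e undefined .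
  let ?r = undefined and ?t = "third undefined undefined" and ?C = coord_ring
  have rt: "?r \<noteq> ?t" by (rule third)
  interpret C: ring ?C by (rule ring_coord_ring)
  define f where "f x = x ?r ?t" for x :: "'n \<Rightarrow> 'n \<Rightarrow> 'a"
  define R where "R = image_ring f ?C"
  have f: "inj_on f (carrier ?C)"
    using coord_ring_bij[OF rt] unfolding f_def bij_betw_def by blast
  have R: "ring R" unfolding R_def by (rule C.inj_imp_image_ring_is_ring[OF f])
  define g where "g = inv_into (carrier ?C) f"
  have g: "g \<in> ring_iso R ?C"
    unfolding g_def R_def by (rule ring_iso_set_sym[OF ring_coord_ring inj_imp_image_ring_iso[OF f]])
  have coh: "coherent (g x)" if "x \<in> carrier R" for x
    using ring_iso_memE(1)[OF g that] by (simp add: coord_ring_def)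
  have "steinberg_family R G (\<lambda>i j x. g x i j)"
    unfolding steinberg_family_def
  proof (intro conjI allI impI; elim conjE)
    show "g x i j \<in> carrier G" if "x \<in> carrier R" for i j x
      using coherent_carrier[OF coh[OF that]] .
    show "g (x \<oplus>\<^bsub>R\<^esub> y) i j = g x i j \<otimes> g y i j"
      if "x \<in> carrier R" "y \<in> carrier R" for i j x y
      using ring_iso_memE(3)[OF g that] by (simp add: coord_ring_def)
    show "g x i j \<star> g y j k = g (x \<otimes>\<^bsub>R\<^esub> y) i k"
      if "i \<noteq> j" "j \<noteq> k" "i \<noteq> k" "x \<in> carrier R" "y \<in> carrier R" for i j k x y
      using ring_iso_memE(2)[OF g that(4,5)] fam_mult_eq[OF coh[OF that(4)] coh[OF that(5)], of i j k]
        that by (simp add: coord_ring_def)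
    show "g x i j \<star> g y k l = \<one>"
      if "i \<noteq> j" "k \<noteq> l" "j \<noteq> k" "i \<noteq> l" "x \<in> carrier R" "y \<in> carrier R" for i j k l x y
      using X_commute[OF that(1-4)] coherentD(2)[OF coh[OF that(5)] that(1)]
        coherentD(2)[OF coh[OF that(6)] that(2)] that(1,2) commutator_eq_one_iff X_carrier
      by metis
  qed
  moreover have "bij_betw (\<lambda>x. g x i j) (carrier R) (X i j)" if "i \<noteq> j" for i j
    using bij_betw_trans[OF ring_iso_memE(5)[OF g] coord_ring_bij[OF that]]
    by (simp add: comp_def)
  ultimately show ?thesis using R by blast
qed


section \<open>Homomorphisms inducing isomorphisms between the root subgroups\<close>

text \<open>Additivity on root subgroups is one of the Steinberg relations, so only bijectivity
  remains to be required.\<close>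

lemma root_iso_homs_iff:
  fixes Gs :: "real ^ 'n::finite \<Rightarrow> 'g set"
  assumes R: "ring R" and G: "group G"
  shows "Q \<in> root_iso_homs R G Gs \<longleftrightarrow> Q \<in> hom (steinberg R) G \<and>
    (\<forall>i j. i \<noteq> j \<longrightarrow>
       bij_betw (\<lambda>x. Q (steinberg_elt R i j x)) (carrier R) (Gs (axis i 1 - axis j 1)))"
proof -
  have "(\<lambda>x. Q (steinberg_elt R i j x)) \<in> iso (add_monoid R) (G\<lparr>carrier := Gs (axis i 1 - axis j 1)\<rparr>)
     \<longleftrightarrow> bij_betw (\<lambda>x. Q (steinberg_elt R i j x)) (carrier R) (Gs (axis i 1 - axis j 1))"
    if Q: "Q \<in> hom (steinberg R) G" and ij: "i \<noteq> j" for i j :: 'n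
  proof -
    have "Q (steinberg_elt R i j (x \<oplus>\<^bsub>R\<^esub> y))
        = Q (steinberg_elt R i j x) \<otimes>\<^bsub>G\<^esub> Q (steinberg_elt R i j y)"
      if "x \<in> carrier R" "y \<in> carrier R" for x y
      using group.steinberg_family_hom[OF G R Q] that ij unfolding steinberg_family_def by blast
    then show ?thesis
      by (auto simp: iso_def hom_def bij_betw_def)
  qed
  then show ?thesis unfolding root_iso_homs_def by blast
qed

section \<open>Twisting by ring isomorphisms and units\<close>

lemma (in monoid) Units_cancel_inv [simp]:
  assumes "u \<in> Units G" "x \<in> carrier G"
  shows "inv u \<otimes> (u \<otimes> x) = x" "u \<otimes> (inv u \<otimes> x) = x"
  using assms by (simp_all add: Units_closed flip: m_assoc)

lemma (in monoid) Units_inv_mult: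
  assumes "u \<in> Units G" "v \<in> Units G"
  shows "inv (u \<otimes> v) = inv v \<otimes> inv u"
  by (rule inv_unique'[symmetric]) (use assms in \<open>simp_all add: m_assoc Units_closed\<close>)

lemma (in monoid) Units_sandwich_bij:
  assumes "u \<in> Units G" "v \<in> Units G"
  shows "bij_betw (\<lambda>x. u \<otimes> x \<otimes> v) (carrier G) (carrier G)"
  by (rule bij_betw_byWitness[where f' = "\<lambda>x. inv u \<otimes> x \<otimes> inv v"])
    (use assms in \<open>auto simp: m_assoc Units_closed\<close>)

lemma twist_bij:
  assumes "ring R" "twisting_data R' R F a"
  shows "bij_betw (\<lambda>x. a i \<otimes>\<^bsub>R\<^esub> F x \<otimes>\<^bsub>R\<^esub> inv\<^bsub>R\<^esub> (a j)) (carrier R') (carrier R)"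
proof -
  interpret ring R by fact
  have "bij_betw F (carrier R') (carrier R)" and "\<And>i. a i \<in> Units R"
    using assms(2) by (auto simp: twisting_data_def ring_iso_memE(5))
  then show ?thesis
    using bij_betw_trans[of F "carrier R'" "carrier R" "\<lambda>x. a i \<otimes>\<^bsub>R\<^esub> x \<otimes>\<^bsub>R\<^esub> inv\<^bsub>R\<^esub> (a j)"]
      Units_sandwich_bij by (simp add: comp_def)
qed

text \<open>In a product over the indices \<open>i\<close>, \<open>j\<close>, \<open>k\<close> the
  inner factors \<open>inv (a j)\<close> and \<open>a j\<close> cancel, so the Steinberg relations
  persist.\<close>

lemma (in group) twist_family:
  fixes a :: "'n::finite \<Rightarrow> 'r"
  assumes R: "ring R" and R': "ring R'" and Q: "Q \<in> hom (steinberg R) G"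
    and F: "twisting_data R' R F a"
  shows "steinberg_family R' G
    (\<lambda>i j x. Q (steinberg_elt R i j (a i \<otimes>\<^bsub>R\<^esub> F x \<otimes>\<^bsub>R\<^esub> inv\<^bsub>R\<^esub> (a j))))"
proof -
  interpret R: ring R by (rule R)
  have Fiso: "F \<in> ring_iso R' R" and U: "\<And>i. a i \<in> Units R"
    using F by (auto simp: twisting_data_def)
  note F_simps = ring_iso_memE(1-3)[OF Fiso]
  have fam: "steinberg_family R G (\<lambda>i j x. Q (steinberg_elt R i j x))"
    by (rule steinberg_family_hom[OF R Q])
  show ?thesis
    using fam unfolding steinberg_family_def
    by (auto simp: F_simps U R.Units_closed R.m_assoc R.l_distr R.r_distr)
qed

text \<open>The maps \<open>f i j\<close> compare two coordinatizations. Their products are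
  controlled for three distinct indices only, which is the reason for the detours through a third
  index below.\<close>

lemma twist_exists:
  fixes f :: "'n::finite \<Rightarrow> 'n \<Rightarrow> 's \<Rightarrow> 'r"
  assumes R: "ring R" and R': "ring R'" and card: "3 \<le> CARD('n)"
    and bij: "\<And>i j. i \<noteq> j \<Longrightarrow> bij_betw (f i j) (carrier R') (carrier R)"
    and add: "\<And>i j x y. i \<noteq> j \<Longrightarrow> x \<in> carrier R' \<Longrightarrow> y \<in> carrier R' \<Longrightarrow>
      f i j (x \<oplus>\<^bsub>R'\<^esub> y) = f i j x \<oplus>\<^bsub>R\<^esub> f i j y"
    and mult: "\<And>i j k x y. distinct [i, j, k] \<Longrightarrow> x \<in> carrier R' \<Longrightarrow> y \<in> carrier R' \<Longrightarrow>
      f i j x \<otimes>\<^bsub>R\<^esub> f j k y = f i k (x \<otimes>\<^bsub>R'\<^esub> y)"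
  shows "\<exists>F a. twisting_data R' R F a \<and> (\<forall>i j x. i \<noteq> j \<and> x \<in> carrier R' \<longrightarrow>
    f i j x = a i \<otimes>\<^bsub>R\<^esub> F x \<otimes>\<^bsub>R\<^esub> inv\<^bsub>R\<^esub> (a j))"
proof -
  interpret R: ring R by (rule R)
  interpret R': ring R' by (rule R')
  have fresh: "\<exists>m. m \<noteq> i \<and> m \<noteq> j" for i j :: 'n
  proof -
    have "card {i, j} \<le> 2" by (simp add: card_insert_if)
    then have "{i, j} \<noteq> UNIV" using card by (intro notI) simp
    then show ?thesis by blast
  qed
  have f_closed [simp]: "f i j x \<in> carrier R" if "i \<noteq> j" "x \<in> carrier R'" for i j x
    using bij[OF that(1)] that(2) by (rule bij_betwE[rule_format])
  define u where "u i j = f i j \<one>\<^bsub>R'\<^esub>" for i j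
  have u_closed [simp]: "u i j \<in> carrier R" if "i \<noteq> j" for i j using that by (simp add: u_def)
  have u_comp: "u i j \<otimes>\<^bsub>R\<^esub> u j k = u i k" if "distinct [i, j, k]" for i j k
    using mult[OF that, of "\<one>\<^bsub>R'\<^esub>" "\<one>\<^bsub>R'\<^esub>"] by (simp add: u_def)
  have u_Units: "u i j \<in> Units R" if ij: "i \<noteq> j" for i j
  proof -
    obtain k where k: "k \<noteq> i" "k \<noteq> j" using fresh by blast
    have "\<one>\<^bsub>R\<^esub> \<in> f i k ` carrier R'" "\<one>\<^bsub>R\<^esub> \<in> f k j ` carrier R'"
      \<comment> \<open>Preimages of one at neighbouring positions yield a right and a left inverse
        of \<open>u i j\<close>.\<close>
      using bij[of i k] bij[of k j] k by (auto simp: bij_betw_def)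
    then obtain y z where y: "y \<in> carrier R'" "f i k y = \<one>\<^bsub>R\<^esub>"
      and z: "z \<in> carrier R'" "f k j z = \<one>\<^bsub>R\<^esub>" by (metis imageE)
    have r: "u i j \<otimes>\<^bsub>R\<^esub> f j k y = \<one>\<^bsub>R\<^esub>"
      using mult[of i j k "\<one>\<^bsub>R'\<^esub>" y] y k ij by (auto simp: u_def)
    have l: "f k i z \<otimes>\<^bsub>R\<^esub> u i j = \<one>\<^bsub>R\<^esub>"
      using mult[of k i j z "\<one>\<^bsub>R'\<^esub>"] z k ij by (auto simp: u_def)
    have "f k i z = f j k y"
      using R.inv_unique[OF l r] y z k ij by auto
    then show ?thesis
      unfolding Units_def using r l y z k ij by (auto intro!: bexI[of _ "f j k y"])
  qed
  \<comment> \<open>An arbitrary base index, whose unit is normalised to one.\<close>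
  define o' :: 'n where "o' = undefined"
  define a where "a i = (if i = o' then \<one>\<^bsub>R\<^esub> else u i o')" for i
  have a_Units [simp]: "a i \<in> Units R" for i using u_Units by (auto simp: a_def)
  have a_closed [simp]: "a i \<in> carrier R" for i using R.Units_closed[OF a_Units] .
  have ua: "u i j \<otimes>\<^bsub>R\<^esub> a j = a i" if ij: "i \<noteq> j" for i j
  proof -
    consider "j = o'" | "i = o'" | "distinct [i, j, o']" using ij by auto
    then show ?thesis
    proof cases
      case 1
      then show ?thesis using ij by (simp add: a_def)
    next
      case 2
      \<comment> \<open>The product of \<open>u i j\<close> and \<open>u j i\<close> is not covered
        by \<open>mult\<close>; it is found to be one by cancelling the unit
        \<open>u i m\<close>.\<close>
      obtain m where m: "m \<noteq> i" "m \<noteq> j" using fresh by blast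
      have "(u i j \<otimes>\<^bsub>R\<^esub> u j i) \<otimes>\<^bsub>R\<^esub> u i m = u i j \<otimes>\<^bsub>R\<^esub> u j m"
        using u_comp[of j i m] ij m by (auto simp: R.m_assoc)
      also have "\<dots> = \<one>\<^bsub>R\<^esub> \<otimes>\<^bsub>R\<^esub> u i m" using u_comp[of i j m] ij m by auto
      finally have "(u i j \<otimes>\<^bsub>R\<^esub> u j i \<otimes>\<^bsub>R\<^esub> u i m) \<otimes>\<^bsub>R\<^esub> inv\<^bsub>R\<^esub> (u i m)
          = (\<one>\<^bsub>R\<^esub> \<otimes>\<^bsub>R\<^esub> u i m) \<otimes>\<^bsub>R\<^esub> inv\<^bsub>R\<^esub> (u i m)" by simp
      then have "u i j \<otimes>\<^bsub>R\<^esub> u j i = \<one>\<^bsub>R\<^esub>"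
        using u_Units[of i m] u_closed[of i j] u_closed[of j i] u_closed[of i m] ij m
        by (simp add: R.m_assoc)
      then show ?thesis using 2 ij by (auto simp: a_def)
    next
      case 3
      then show ?thesis using u_comp[of i j o'] by (simp add: a_def)
    qed
  qed
  \<comment> \<open>Stripping off the units makes every \<open>g i j\<close> preserve one.
    Multiplication by one then shows that \<open>g\<close> is constant along rows and
    columns.\<close>
  define g where "g i j x = inv\<^bsub>R\<^esub> (a i) \<otimes>\<^bsub>R\<^esub> f i j x \<otimes>\<^bsub>R\<^esub> a j" for i j x
  have g_closed [simp]: "g i j x \<in> carrier R" if "i \<noteq> j" "x \<in> carrier R'" for i j x
    using that by (simp add: g_def)
  have g_one: "g i j \<one>\<^bsub>R'\<^esub> = \<one>\<^bsub>R\<^esub>" if "i \<noteq> j" for i j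
    using ua[OF that] that by (simp add: g_def R.m_assoc flip: u_def)
  have g_mult: "g i j x \<otimes>\<^bsub>R\<^esub> g j k y = g i k (x \<otimes>\<^bsub>R'\<^esub> y)"
    if d: "distinct [i, j, k]" and xy: "x \<in> carrier R'" "y \<in> carrier R'" for i j k x y
    using d xy f_closed[of i j x] f_closed[of j k y]
    by (simp add: g_def R.m_assoc flip: mult[OF d xy])
  have row: "g i j x = g i k x" if "i \<noteq> j" "i \<noteq> k" "x \<in> carrier R'" for i j k x
    using that g_mult[of i j k x "\<one>\<^bsub>R'\<^esub>"] g_one[of j k] by (cases "j = k") auto
  have column: "g i k x = g j k x" if "i \<noteq> k" "j \<noteq> k" "x \<in> carrier R'" for i j k x
    using that g_mult[of i j k "\<one>\<^bsub>R'\<^esub>" x] g_one[of i j] by (cases "i = j") auto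
  obtain t where t: "o' \<noteq> t" using fresh by metis
  define F where "F = g o' t"
  have gF: "g i j x = F x" if ij: "i \<noteq> j" and x: "x \<in> carrier R'" for i j x
  proof (cases "j = o'")
    case True
    \<comment> \<open>Passing to row \<open>o'\<close> within this column would end on the diagonal,
      so the column is changed first.\<close>
    obtain m where m: "m \<noteq> i" "m \<noteq> o'" using fresh by blast
    have "g i j x = g i m x" using ij x m by (intro row) auto
    also have "\<dots> = g o' m x" using ij x m by (intro column) auto
    also have "\<dots> = g o' t x" using x m t by (intro row) auto
    finally show ?thesis by (simp add: F_def)
  next
    case False
    then have "g i j x = g o' j x" using ij x by (intro column) auto
    also have "\<dots> = g o' t x" using x t False by (intro row) auto
    finally show ?thesis by (simp add: F_def)
  qed
  have "F \<in> ring_iso R' R"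
  proof (rule ring_iso_memI)
    show "F x \<in> carrier R" if "x \<in> carrier R'" for x using that t by (simp add: F_def)
    show "F (x \<oplus>\<^bsub>R'\<^esub> y) = F x \<oplus>\<^bsub>R\<^esub> F y" if "x \<in> carrier R'" "y \<in> carrier R'" for x y
      using that t by (simp add: F_def g_def add R.l_distr R.r_distr)
    show "F \<one>\<^bsub>R'\<^esub> = \<one>\<^bsub>R\<^esub>" using g_one[OF t] by (simp add: F_def)
    show "F (x \<otimes>\<^bsub>R'\<^esub> y) = F x \<otimes>\<^bsub>R\<^esub> F y" if xy: "x \<in> carrier R'" "y \<in> carrier R'" for x y
    proof -
      obtain m where m: "m \<noteq> o'" "m \<noteq> t" using fresh by blast
      show ?thesis
        using g_mult[of o' m t x y] gF[of o' m x] gF[of m t y] gF[of o' t "x \<otimes>\<^bsub>R'\<^esub> y"] m t xy by auto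
    qed
    have "bij_betw (\<lambda>x. inv\<^bsub>R\<^esub> (a o') \<otimes>\<^bsub>R\<^esub> x \<otimes>\<^bsub>R\<^esub> a t) (carrier R) (carrier R)"
      by (intro R.Units_sandwich_bij) auto
    from bij_betw_trans[OF bij[OF t] this] show "bij_betw F (carrier R') (carrier R)"
      by (simp add: F_def g_def comp_def cong: bij_betw_cong)
  qed
  moreover have "f i j x = a i \<otimes>\<^bsub>R\<^esub> F x \<otimes>\<^bsub>R\<^esub> inv\<^bsub>R\<^esub> (a j)" if "i \<noteq> j" "x \<in> carrier R'" for i j x
    using that unfolding gF[OF that, symmetric] by (simp add: g_def R.m_assoc)
  ultimately show ?thesis
    using a_Units unfolding twisting_data_def by blast
qed

text \<open>Inserting the one of the ring shows that the products of \<open>inv (a k)\<close> with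
  \<open>a' k\<close> do not depend on \<open>k\<close>; their common value is \<open>c\<close>.
  Solving the equation for \<open>F' x\<close> then gives the conjugation.\<close>

lemma twist_unique:
  fixes a a' :: "'n::finite \<Rightarrow> 'r"
  assumes R: "ring R" and R': "ring R'" and F: "twisting_data R' R F a"
    and F': "twisting_data R' R F' a'" and ij: "i \<noteq> (j :: 'n)"
    and eq: "\<And>i j x. i \<noteq> j \<Longrightarrow> x \<in> carrier R' \<Longrightarrow>
      a i \<otimes>\<^bsub>R\<^esub> F x \<otimes>\<^bsub>R\<^esub> inv\<^bsub>R\<^esub> (a j) = a' i \<otimes>\<^bsub>R\<^esub> F' x \<otimes>\<^bsub>R\<^esub> inv\<^bsub>R\<^esub> (a' j)"
  shows "\<exists>c\<in>Units R. (\<forall>x\<in>carrier R'. F' x = inv\<^bsub>R\<^esub> c \<otimes>\<^bsub>R\<^esub> F x \<otimes>\<^bsub>R\<^esub> c) \<and>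
    (\<forall>i. a' i = a i \<otimes>\<^bsub>R\<^esub> c)"
proof -
  interpret R: ring R by (rule R)
  interpret R': ring R' by (rule R')
  have Fiso: "F \<in> ring_iso R' R" "F' \<in> ring_iso R' R"
    and U [simp]: "a i \<in> Units R" "a' i \<in> Units R" for i
    using F F' by (auto simp: twisting_data_def)
  have [simp]: "a i \<in> carrier R" "a' i \<in> carrier R" for i using U R.Units_closed by auto
  have [simp]: "F x \<in> carrier R" "F' x \<in> carrier R" if "x \<in> carrier R'" for x
    using ring_iso_memE(1) Fiso that by metis+
  define c where "c = inv\<^bsub>R\<^esub> (a j) \<otimes>\<^bsub>R\<^esub> a' j"
  have c [simp]: "c \<in> Units R" "c \<in> carrier R" by (simp_all add: c_def)
  have a': "a' k = a k \<otimes>\<^bsub>R\<^esub> c" for k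
  proof (cases "k = j")
    case False
    have "a k \<otimes>\<^bsub>R\<^esub> inv\<^bsub>R\<^esub> (a j) = a' k \<otimes>\<^bsub>R\<^esub> inv\<^bsub>R\<^esub> (a' j)"
      using eq[OF False, of "\<one>\<^bsub>R'\<^esub>"] by (simp add: ring_iso_memE(4)[OF Fiso(1)] ring_iso_memE(4)[OF Fiso(2)])
    then have "a k \<otimes>\<^bsub>R\<^esub> inv\<^bsub>R\<^esub> (a j) \<otimes>\<^bsub>R\<^esub> a' j = a' k \<otimes>\<^bsub>R\<^esub> inv\<^bsub>R\<^esub> (a' j) \<otimes>\<^bsub>R\<^esub> a' j" by simp
    then show ?thesis by (simp add: c_def R.m_assoc)
  qed (simp add: c_def)
  have "F' x = inv\<^bsub>R\<^esub> c \<otimes>\<^bsub>R\<^esub> F x \<otimes>\<^bsub>R\<^esub> c" if x: "x \<in> carrier R'" for x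
  proof -
    have "inv\<^bsub>R\<^esub> (a' i) \<otimes>\<^bsub>R\<^esub> (a i \<otimes>\<^bsub>R\<^esub> F x \<otimes>\<^bsub>R\<^esub> inv\<^bsub>R\<^esub> (a j)) \<otimes>\<^bsub>R\<^esub> a' j = F' x"
      using x unfolding eq[OF ij x] by (simp add: R.m_assoc)
    moreover have "inv\<^bsub>R\<^esub> (a' i) \<otimes>\<^bsub>R\<^esub> (a i \<otimes>\<^bsub>R\<^esub> F x \<otimes>\<^bsub>R\<^esub> inv\<^bsub>R\<^esub> (a j)) \<otimes>\<^bsub>R\<^esub> a' j
        = inv\<^bsub>R\<^esub> c \<otimes>\<^bsub>R\<^esub> F x \<otimes>\<^bsub>R\<^esub> c"
      using x unfolding a' by (simp add: R.m_assoc R.Units_inv_mult)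
    ultimately show ?thesis by simp
  qed
  then show ?thesis using a' c by blast
qed

lemma twist_change:
  fixes a a' :: "'n::finite \<Rightarrow> 'r"
  assumes R: "ring R" and R': "ring R'" and F: "twisting_data R' R F a" and c: "c \<in> Units R"
    and F': "\<And>x. x \<in> carrier R' \<Longrightarrow> F' x = inv\<^bsub>R\<^esub> c \<otimes>\<^bsub>R\<^esub> F x \<otimes>\<^bsub>R\<^esub> c"
    and a': "\<And>i. a' i = a i \<otimes>\<^bsub>R\<^esub> c"
  shows "twisting_data R' R F' a'"
    and "x \<in> carrier R' \<Longrightarrow>
      a' i \<otimes>\<^bsub>R\<^esub> F' x \<otimes>\<^bsub>R\<^esub> inv\<^bsub>R\<^esub> (a' j) = a i \<otimes>\<^bsub>R\<^esub> F x \<otimes>\<^bsub>R\<^esub> inv\<^bsub>R\<^esub> (a j)"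
proof -
  interpret R: ring R by (rule R)
  interpret R': ring R' by (rule R')
  have Fiso: "F \<in> ring_iso R' R" and U [simp]: "a i \<in> Units R" for i
    using F by (auto simp: twisting_data_def)
  note [simp] = c R.Units_closed[OF c] R.Units_closed[OF U] ring_iso_memE(1)[OF Fiso]
  show "a' i \<otimes>\<^bsub>R\<^esub> F' x \<otimes>\<^bsub>R\<^esub> inv\<^bsub>R\<^esub> (a' j) = a i \<otimes>\<^bsub>R\<^esub> F x \<otimes>\<^bsub>R\<^esub> inv\<^bsub>R\<^esub> (a j)"
    if "x \<in> carrier R'"
    using that by (simp add: F' a' R.m_assoc R.Units_inv_mult)
  have "bij_betw (\<lambda>x. inv\<^bsub>R\<^esub> c \<otimes>\<^bsub>R\<^esub> F x \<otimes>\<^bsub>R\<^esub> c) (carrier R') (carrier R)"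
    using bij_betw_trans[OF ring_iso_memE(5)[OF Fiso] R.Units_sandwich_bij[of "inv\<^bsub>R\<^esub> c" c]]
    by (simp add: comp_def)
  then have "bij_betw F' (carrier R') (carrier R)"
    by (simp add: F' cong: bij_betw_cong)
  moreover have "F' \<in> ring_hom R' R"
    by (rule ring_hom_memI) (use ring_iso_memE(1-4)[OF Fiso] in \<open>simp_all add: F' R.m_assoc R.l_distr R.r_distr\<close>)
  ultimately show "twisting_data R' R F' a'"
    by (simp add: twisting_data_def ring_iso_def a')
qed

text \<open>The map \<open>f i j\<close> takes a coordinate with respect to \<open>Q'\<close> to
  that of the same group element with respect to \<open>Q\<close>. Injectivity of \<open>Q\<close>
  on coordinates turns the relations in the group into identities of the ring.\<close>

lemma (in group) root_iso_homs_twist: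
  fixes Gs :: "real ^ 'n::finite \<Rightarrow> 'a set"
  assumes R: "ring R" and R': "ring R'" and card: "3 \<le> CARD('n)"
    and Q: "Q \<in> root_iso_homs R G Gs" and Q': "Q' \<in> root_iso_homs R' G Gs"
  shows "\<exists>F a. twisting_data R' R F a \<and> is_twist R' R F a Q Q'"
proof -
  interpret R: ring R by (rule R)
  interpret R': ring R' by (rule R')
  let ?t = "\<lambda>i j x. Q (steinberg_elt R i j x)" and ?t' = "\<lambda>i j x. Q' (steinberg_elt R' i j x)"
  have Qb: "bij_betw (?t i j) (carrier R) (Gs (axis i 1 - axis j 1))"
    and Qb': "bij_betw (?t' i j) (carrier R') (Gs (axis i 1 - axis j 1))" if "i \<noteq> j" for i j
    using Q Q' root_iso_homs_iff[OF R is_group] root_iso_homs_iff[OF R' is_group] that by blast+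
  have fam: "steinberg_family R G ?t" "steinberg_family R' G ?t'"
    using Q Q' by (auto intro!: steinberg_family_hom R R' simp: root_iso_homs_def)
  define f where "f i j x = inv_into (carrier R) (?t i j) (?t' i j x)" for i j x
  have f: "f i j x \<in> carrier R" "?t i j (f i j x) = ?t' i j x"
    if "i \<noteq> j" "x \<in> carrier R'" for i j x
  proof -
    have "?t' i j x \<in> ?t i j ` carrier R"
      using Qb[OF that(1)] Qb'[OF that(1)] that(2) by (auto simp: bij_betw_def)
    then show "f i j x \<in> carrier R" "?t i j (f i j x) = ?t' i j x"
      unfolding f_def by (auto intro: inv_into_into f_inv_into_f)
  qed
  have inj: "x = y" if "i \<noteq> j" "x \<in> carrier R" "y \<in> carrier R" "?t i j x = ?t i j y" for i j x y
    using Qb[OF that(1)] that unfolding bij_betw_def by (meson inj_onD)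
  have "bij_betw (f i j) (carrier R') (carrier R)" if "i \<noteq> j" for i j
    using bij_betw_trans[OF Qb'[OF that] bij_betw_inv_into[OF Qb[OF that]]]
    by (simp add: f_def comp_def cong: bij_betw_cong)
  moreover have "f i j (x \<oplus>\<^bsub>R'\<^esub> y) = f i j x \<oplus>\<^bsub>R\<^esub> f i j y"
    if "i \<noteq> j" "x \<in> carrier R'" "y \<in> carrier R'" for i j x y
    by (rule inj[OF that(1)]) (use that f fam in \<open>simp_all add: steinberg_family_def\<close>)
  moreover have "f i j x \<otimes>\<^bsub>R\<^esub> f j k y = f i k (x \<otimes>\<^bsub>R'\<^esub> y)"
    if "distinct [i, j, k]" "x \<in> carrier R'" "y \<in> carrier R'" for i j k x y
  proof (rule inj[of i k])
    have d: "i \<noteq> j \<and> j \<noteq> k \<and> i \<noteq> k" using that(1) by auto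
    then show "i \<noteq> k" "f i j x \<otimes>\<^bsub>R\<^esub> f j k y \<in> carrier R" "f i k (x \<otimes>\<^bsub>R'\<^esub> y) \<in> carrier R"
      using that f by auto
    have "?t i k (f i j x \<otimes>\<^bsub>R\<^esub> f j k y) = commutator G (?t i j (f i j x)) (?t j k (f j k y))"
      using fam(1) d that f unfolding steinberg_family_def by metis
    also have "\<dots> = commutator G (?t' i j x) (?t' j k y)" using d that f by simp
    also have "\<dots> = ?t' i k (x \<otimes>\<^bsub>R'\<^esub> y)"
      using fam(2) d that unfolding steinberg_family_def by metis
    also have "\<dots> = ?t i k (f i k (x \<otimes>\<^bsub>R'\<^esub> y))" using d that f by simp
    finally show "?t i k (f i j x \<otimes>\<^bsub>R\<^esub> f j k y) = ?t i k (f i k (x \<otimes>\<^bsub>R'\<^esub> y))" .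
  qed
  ultimately have "\<exists>F a. twisting_data R' R F a \<and> (\<forall>i j x. i \<noteq> j \<and> x \<in> carrier R' \<longrightarrow>
      f i j x = a i \<otimes>\<^bsub>R\<^esub> F x \<otimes>\<^bsub>R\<^esub> inv\<^bsub>R\<^esub> (a j))"
    by (rule twist_exists[OF R R' card])
  then obtain F a where F: "twisting_data R' R F a"
    and fF: "i \<noteq> j \<Longrightarrow> x \<in> carrier R' \<Longrightarrow> f i j x = a i \<otimes>\<^bsub>R\<^esub> F x \<otimes>\<^bsub>R\<^esub> inv\<^bsub>R\<^esub> (a j)" for i j x
    by blast
  have "is_twist R' R F a Q Q'"
    unfolding is_twist_def using f(2) fF by metis
  with F show ?thesis by blast
qed

text \<open>Membership in \<open>hom\<close> leaves the values off the carrier free; extensionality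
  fixes them and gives uniqueness as a function.\<close>

lemma (in group) twist_hom_exists_unique:
  fixes a :: "'n::finite \<Rightarrow> 'r"
  assumes R: "ring R" and R': "ring R'" and Q: "Q \<in> hom (steinberg R) G"
    and F: "twisting_data R' R F a"
  shows "\<exists>!Q'. Q' \<in> hom (steinberg R') G \<and> Q' \<in> extensional (carrier (steinberg R')) \<and>
    is_twist R' R F a Q Q'"
proof -
  let ?St = "steinberg R' :: ('n \<times> 'n \<times> _) word set monoid"
  interpret St: group ?St unfolding steinberg_def by (rule group_presented_group)
  have elt: "steinberg_elt R' i j x \<in> carrier ?St" if "i \<noteq> j" "x \<in> carrier R'" for i j :: 'n and x
    using that by (auto simp: steinberg_elt_def steinberg_def presented_group_def quotient_def
        steinberg_gens_def)
  obtain P where P: "P \<in> hom ?St G"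
    "\<And>i j x. i \<noteq> j \<Longrightarrow> x \<in> carrier R' \<Longrightarrow> P (steinberg_elt R' i j x)
       = Q (steinberg_elt R i j (a i \<otimes>\<^bsub>R\<^esub> F x \<otimes>\<^bsub>R\<^esub> inv\<^bsub>R\<^esub> (a j)))"
    using steinberg_hom_exists[OF R' twist_family[OF R R' Q F]] by blast
  show ?thesis
  proof (rule ex1I[of _ "restrict P (carrier ?St)"], intro conjI)
    show "restrict P (carrier ?St) \<in> hom ?St G"
      using P(1) by (auto simp: hom_def)
    show "is_twist R' R F a Q (restrict P (carrier ?St))"
      using P(2) elt by (auto simp: is_twist_def)
  next
    fix Q' assume Q': "Q' \<in> hom ?St G \<and> Q' \<in> extensional (carrier ?St) \<and> is_twist R' R F a Q Q'"
    have "Q' A = P A" if "A \<in> carrier ?St" for A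
      by (rule steinberg_hom_unique[OF _ P(1) _ that])
        (use Q' P(2) in \<open>auto simp: is_twist_def\<close>)
    then show "Q' = restrict P (carrier ?St)"
      using Q' by (intro extensionalityI[of _ "carrier ?St"]) auto
  qed simp
qed

lemma (in group) twist_root_iso_homs:
  fixes Gs :: "real ^ 'n::finite \<Rightarrow> 'a set"
  assumes R: "ring R" and R': "ring R'" and Q: "Q \<in> root_iso_homs R G Gs"
    and F: "twisting_data R' R F a" and Q': "Q' \<in> hom (steinberg R') G" "is_twist R' R F a Q Q'"
  shows "Q' \<in> root_iso_homs R' G Gs"
  unfolding root_iso_homs_iff[OF R' is_group]
proof (intro conjI allI impI Q'(1))
  fix i j :: 'n assume ij: "i \<noteq> j"
  then have "bij_betw (\<lambda>x. Q (steinberg_elt R i j x)) (carrier R) (Gs (axis i 1 - axis j 1))"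
    using Q unfolding root_iso_homs_iff[OF R is_group] by blast
  from bij_betw_trans[OF twist_bij[OF R F] this]
  have "bij_betw (\<lambda>x. Q (steinberg_elt R i j (a i \<otimes>\<^bsub>R\<^esub> F x \<otimes>\<^bsub>R\<^esub> inv\<^bsub>R\<^esub> (a j)))) (carrier R')
      (Gs (axis i 1 - axis j 1))"
    by (simp add: comp_def)
  moreover have "Q' (steinberg_elt R' i j x)
      = Q (steinberg_elt R i j (a i \<otimes>\<^bsub>R\<^esub> F x \<otimes>\<^bsub>R\<^esub> inv\<^bsub>R\<^esub> (a j)))" if "x \<in> carrier R'" for x
    using Q'(2) ij that unfolding is_twist_def by blast
  ultimately show "bij_betw (\<lambda>x. Q' (steinberg_elt R' i j x)) (carrier R') (Gs (axis i 1 - axis j 1))"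
    by (simp cong: bij_betw_cong)
qed

text \<open>Injectivity of \<open>Q\<close> on coordinates removes \<open>Q\<close> from the
  equations and reduces uniqueness to \<open>twist_unique\<close>; conversely, \<open>c\<close>
  cancels in the twisted coordinates.\<close>

lemma (in group) twist_data_unique:
  fixes Gs :: "real ^ 'n::finite \<Rightarrow> 'a set"
  assumes R: "ring R" and R': "ring R'" and card: "2 \<le> CARD('n)"
    and Q: "Q \<in> root_iso_homs R G Gs"
    and F: "twisting_data R' R F a" "is_twist R' R F a Q Q'"
  shows "twisting_data R' R F' a' \<and> is_twist R' R F' a' Q Q' \<longleftrightarrow>
    (\<exists>c\<in>Units R. (\<forall>x\<in>carrier R'. F' x = inv\<^bsub>R\<^esub> c \<otimes>\<^bsub>R\<^esub> F x \<otimes>\<^bsub>R\<^esub> c) \<and>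
      (\<forall>i. a' i = a i \<otimes>\<^bsub>R\<^esub> c))" (is "?L \<longleftrightarrow> ?R")
proof
  assume L: ?L
  have "\<not> is_singleton (UNIV :: 'n set)" using card by (simp add: is_singleton_altdef)
  then obtain i j :: 'n where ij: "i \<noteq> j" unfolding is_singleton_def
    by (metis UNIV_eq_I singleton_iff)
  have eq: "a i \<otimes>\<^bsub>R\<^esub> F x \<otimes>\<^bsub>R\<^esub> inv\<^bsub>R\<^esub> (a j) = a' i \<otimes>\<^bsub>R\<^esub> F' x \<otimes>\<^bsub>R\<^esub> inv\<^bsub>R\<^esub> (a' j)"
    if ij: "i \<noteq> j" and x: "x \<in> carrier R'" for i j x
  proof -
    have "inj_on (\<lambda>x. Q (steinberg_elt R i j x)) (carrier R)"
      using Q ij unfolding root_iso_homs_iff[OF R is_group] bij_betw_def by blast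
    moreover have "Q (steinberg_elt R i j (a i \<otimes>\<^bsub>R\<^esub> F x \<otimes>\<^bsub>R\<^esub> inv\<^bsub>R\<^esub> (a j)))
        = Q (steinberg_elt R i j (a' i \<otimes>\<^bsub>R\<^esub> F' x \<otimes>\<^bsub>R\<^esub> inv\<^bsub>R\<^esub> (a' j)))"
      using F(2) L ij x unfolding is_twist_def by metis
    moreover have "a i \<otimes>\<^bsub>R\<^esub> F x \<otimes>\<^bsub>R\<^esub> inv\<^bsub>R\<^esub> (a j) \<in> carrier R"
      "a' i \<otimes>\<^bsub>R\<^esub> F' x \<otimes>\<^bsub>R\<^esub> inv\<^bsub>R\<^esub> (a' j) \<in> carrier R"
      using bij_betwE[OF twist_bij[OF R F(1)]] bij_betwE[OF twist_bij[OF R conjunct1[OF L]]] x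
      by blast+
    ultimately show ?thesis by (meson inj_onD)
  qed
  show ?R using twist_unique[OF R R' F(1) _ ij eq] L by blast
next
  assume ?R
  then obtain c where c: "c \<in> Units R" "\<And>x. x \<in> carrier R' \<Longrightarrow> F' x = inv\<^bsub>R\<^esub> c \<otimes>\<^bsub>R\<^esub> F x \<otimes>\<^bsub>R\<^esub> c"
    "\<And>i. a' i = a i \<otimes>\<^bsub>R\<^esub> c" by blast
  show ?L
    using twist_change[OF R R' F(1) c] F(2) unfolding is_twist_def by metis
qed

theorem theorem2:
  fixes G :: "('g, 'z) monoid_scheme" and Gs :: "real ^ 'n \<Rightarrow> 'g set" and l :: nat
  assumes "l \<ge> 3" and "CARD('n) = l + 1"
    and "graded_group (A_roots :: (real ^ 'n) set) G Gs"
  shows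
    "(\<exists>(R :: 'g ring) Q. ring R \<and> Q \<in> root_iso_homs R G Gs) \<and>
     (\<forall>(R :: ('r, 'k) ring_scheme) Q. ring R \<and> Q \<in> root_iso_homs R G Gs \<longrightarrow>
       (\<forall>R' :: ('s, 'm) ring_scheme. ring R' \<longrightarrow>
         (\<forall>Q' \<in> root_iso_homs R' G Gs.
            \<exists>F a. twisting_data R' R F a \<and> is_twist R' R F a Q Q') \<and>
         (\<forall>F a. twisting_data R' R F a \<longrightarrow>
            (\<exists>!Q'. Q' \<in> hom (steinberg R') G \<and> Q' \<in> extensional (carrier (steinberg R'))
                   \<and> is_twist R' R F a Q Q') \<and>
            (\<forall>Q' \<in> hom (steinberg R') G.
               is_twist R' R F a Q Q' \<longrightarrow> Q' \<in> root_iso_homs R' G Gs)) \<and>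
         (\<forall>Q' \<in> root_iso_homs R' G Gs. \<forall>F a.
            twisting_data R' R F a \<and> is_twist R' R F a Q Q' \<longrightarrow>
            (\<forall>F' a'. twisting_data R' R F' a' \<and> is_twist R' R F' a' Q Q' \<longleftrightarrow>
               (\<exists>c \<in> Units R.
                  (\<forall>x \<in> carrier R'. F' x = inv\<^bsub>R\<^esub> c \<otimes>\<^bsub>R\<^esub> F x \<otimes>\<^bsub>R\<^esub> c) \<and>
                  (\<forall>i. a' i = a i \<otimes>\<^bsub>R\<^esub> c))))))"
proof (intro conjI allI ballI impI)
  interpret A_graded G "\<lambda>i j. Gs (axis i 1 - axis j 1)"
    by (rule graded_group_A_graded) (use assms in auto)
  have G: "group G" by (rule is_group)
  show "\<exists>(R :: 'g ring) Q. ring R \<and> Q \<in> root_iso_homs R G Gs"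
  proof -
    obtain R :: "'g ring" and \<phi> where R: "ring R" "steinberg_family R G \<phi>"
      and \<phi>: "\<And>i j. i \<noteq> j \<Longrightarrow> bij_betw (\<phi> i j) (carrier R) (Gs (axis i 1 - axis j 1))"
      using coordinatization by blast
    obtain Q where Q: "Q \<in> hom (steinberg R) G"
      "\<And>i j x. i \<noteq> j \<Longrightarrow> x \<in> carrier R \<Longrightarrow> Q (steinberg_elt R i j x) = \<phi> i j x"
      using steinberg_hom_exists[OF R] by blast
    have "Q \<in> root_iso_homs R G Gs"
      unfolding root_iso_homs_iff[OF R(1) G] using Q \<phi> by (simp cong: bij_betw_cong)
    with R show ?thesis by blast
  qed
  fix R :: "('r, 'k) ring_scheme" and Q and R' :: "('s, 'm) ring_scheme"
  assume RQ: "ring R \<and> Q \<in> root_iso_homs R G Gs" and R': "ring R'"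
  then have R: "ring R" and Q: "Q \<in> root_iso_homs R G Gs" by auto
  show "\<exists>F a. twisting_data R' R F a \<and> is_twist R' R F a Q Q'"
    if "Q' \<in> root_iso_homs R' G Gs" for Q'
    by (rule root_iso_homs_twist[OF R R' _ Q that]) (use assms in simp)
  fix F and a :: "'n \<Rightarrow> 'r"
  show "\<exists>!Q'. Q' \<in> hom (steinberg R') G \<and> Q' \<in> extensional (carrier (steinberg R'))
      \<and> is_twist R' R F a Q Q'" if "twisting_data R' R F a"
    by (rule twist_hom_exists_unique[OF R R' _ that]) (use Q in \<open>simp add: root_iso_homs_def\<close>)
  show "Q' \<in> root_iso_homs R' G Gs"
    if "twisting_data R' R F a" "Q' \<in> hom (steinberg R') G" "is_twist R' R F a Q Q'" for Q'
    by (rule twist_root_iso_homs[OF R R' Q that])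
  show "twisting_data R' R F' a' \<and> is_twist R' R F' a' Q Q' \<longleftrightarrow>
      (\<exists>c \<in> Units R. (\<forall>x \<in> carrier R'. F' x = inv\<^bsub>R\<^esub> c \<otimes>\<^bsub>R\<^esub> F x \<otimes>\<^bsub>R\<^esub> c) \<and>
        (\<forall>i. a' i = a i \<otimes>\<^bsub>R\<^esub> c))"
    if "twisting_data R' R F a \<and> is_twist R' R F a Q Q'" for Q' F' a'
    by (rule twist_data_unique[OF R R' _ Q]) (use assms that in simp_all)
qed

end
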